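(* Let $\mu$ be a Borel measure on $[0,1]^2$. Assume that $\mu$ detects pseudotruths and is automorphism-invariant. Then $\mu=\lambda$.
   Context: Here $\lambda$ denotes the Lebesgue measure on $[0,1]^2$. The free MV-algebra on $2$ generators is identified with the algebra of McNaughton functions on $[0,1]^2$: continuous functions $f:[0,1]^2\to[0,1]$ for which there is a finite complex of compact convex polyhedra with rational vertices covering $[0,1]^2$ (closed under faces, any two meeting in a common face) such that on each $2$-dimensional polyhedron $f$ coincides with an affine function $a_1x_1+a_2x_2+a_3$ with $a_i\in\mathbb{Z}$. A McNaughton homeomorphism of $[0,1]^2$ is a homeomorphism $S$ of $[0,1]^2$ for which there is such a complex and matrices $P_j\in\mathrm{Mat}_3(\mathbb{Z})$, one for each $2$-dimensional polyhedron $C_j$, each with last row $(0\,0\,1)$, such that $P_j$ expresses $S\restriction C_j$ in homogeneous coordinates, and all $P_j$ have determinant $+1$ or all have determinant $-1$; these are exactly the duals of the automorphisms of the free MV-algebra. The measure $\mu$ is automorphism-invariant if $\mu(A)=\mu(S^{-1}A)$ for every Borel $A\subseteq[0,1]^2$ and every McNaughton homeomorphism $S$ (equivalently, $\int f\circ S\,d\mu=\int f\,d\mu$ for all McNaughton functions $f$). The measure $\mu$ detects pseudotruths if for every McNaughton function $f$ whose zero set $\{p:f(p)=0\}$ has empty interior (i.e. $f$ is pseudotrue, having pseudocomplement $0$), $\sup_{k\ge1}\int kf\,d\mu=1$, where $kf=f\oplus\cdots\oplus f$ ($k$ times) and $f\oplus g=\min(1,f+g)$; equivalently, $\mu([0,1]^2)=1$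 and $\mu(|W|)=0$ for every rational polyhedral complex $W$ in $[0,1]^2$ whose union $|W|$ has empty interior. *)

theory Defs
  imports "HOL-Analysis.Analysis"
begin

abbreviation unit_square :: "(real^2) set" where
  "unit_square \<equiv> cbox 0 1"

text \<open>Here \<open>1\<close> is the vector with all entries 1, so the box is \<open>[0,1] \<times> [0,1]\<close>.
  As in the library's \<open>simplicial_complex\<close>, the empty polytope counts as a face.\<close>

definition rational_complex :: "(real^2) set set \<Rightarrow> bool" where
  "rational_complex K \<longleftrightarrow>
     finite K \<and>
     (\<forall>C\<in>K. polytope C \<and> (\<forall>v. v extreme_point_of C \<longrightarrow> (\<forall>i. v $ i \<in> \<rat>))) \<and>
     (\<forall>C\<in>K. \<forall>F. F face_of C \<longrightarrow> F \<in> K) \<and>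
     (\<forall>C\<in>K. \<forall>D\<in>K. (C \<inter> D) face_of C \<and> (C \<inter> D) face_of D)"

definition rational_square_complex :: "(real^2) set set \<Rightarrow> bool" where
  "rational_square_complex K \<longleftrightarrow> rational_complex K \<and> \<Union>K = unit_square"

text \<open>Functions on the square are total functions of which only the values on
  \<^term>\<open>unit_square\<close> matter.\<close>

definition mcnaughton_function :: "(real^2 \<Rightarrow> real) \<Rightarrow> bool" where
  "mcnaughton_function f \<longleftrightarrow>
     continuous_on unit_square f \<and>
     f \<in> unit_square \<rightarrow> {0..1} \<and>
     (\<exists>K. rational_square_complex K \<and>
       (\<forall>C\<in>K. aff_dim C = 2 \<longrightarrow>
         (\<exists>a1 a2 a3 :: int. \<forall>x\<in>C.
            f x = of_int a1 * x $ 1 + of_int a2 * x $ 2 + of_int a3)))"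

definition homogeneous :: "real^2 \<Rightarrow> real^3" where
  "homogeneous x = vector [x $ 1, x $ 2, 1]"

definition mcnaughton_homeomorphism :: "(real^2 \<Rightarrow> real^2) \<Rightarrow> bool" where
  "mcnaughton_homeomorphism S \<longleftrightarrow>
     (\<exists>T. homeomorphism unit_square unit_square S T) \<and>
     (\<exists>K (P :: (real^2) set \<Rightarrow> int^3^3).
       rational_square_complex K \<and>
       (\<forall>C\<in>K. aff_dim C = 2 \<longrightarrow>
          P C $ 3 = vector [0, 0, 1] \<and>
          (\<forall>x\<in>C. homogeneous (S x) = map_matrix of_int (P C) *v homogeneous x)) \<and>
       ((\<forall>C\<in>K. aff_dim C = 2 \<longrightarrow> det (P C) = 1) \<or>
        (\<forall>C\<in>K. aff_dim C = 2 \<longrightarrow> det (P C) = -1)))"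

definition automorphism_invariant :: "(real^2) measure \<Rightarrow> bool" where
  "automorphism_invariant \<mu> \<longleftrightarrow>
     (\<forall>S A. mcnaughton_homeomorphism S \<longrightarrow> A \<in> sets borel \<longrightarrow> A \<subseteq> unit_square \<longrightarrow>
        emeasure \<mu> A = emeasure \<mu> (S -` A \<inter> unit_square))"

definition mv_plus :: "('a \<Rightarrow> real) \<Rightarrow> ('a \<Rightarrow> real) \<Rightarrow> 'a \<Rightarrow> real" where
  "mv_plus f g = (\<lambda>x. min 1 (f x + g x))"

text \<open>For \<open>f\<close> with values in \<open>[0,1]\<close> one has \<open>0 \<oplus> f = f\<close>, so the recursion may start
  from the zero function.\<close>

primrec mv_multiple :: "nat \<Rightarrow> ('a \<Rightarrow> real) \<Rightarrow> 'a \<Rightarrow> real" where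
  "mv_multiple 0 f = (\<lambda>_. 0)"
| "mv_multiple (Suc k) f = mv_plus (mv_multiple k f) f"

text \<open>The interior of the zero set is taken in the topology of the square.  The nonnegative
  integral is used so that no finiteness of \<open>\<mu>\<close> has to be assumed.\<close>

definition detects_pseudotruths :: "(real^2) measure \<Rightarrow> bool" where
  "detects_pseudotruths \<mu> \<longleftrightarrow>
     (\<forall>f. mcnaughton_function f \<longrightarrow>
        top_of_set unit_square interior_of {p \<in> unit_square. f p = 0} = {} \<longrightarrow>
        (SUP k\<in>{1..}. \<integral>\<^sup>+ x. ennreal (mv_multiple k f x) \<partial>\<mu>) = 1)"

end

(*
  Write z = 1 - x - y and let t = min x (min y z) be the level of a point of the triangle
  x, y, z >= 0.  The sets of constant level t are triangles of perimeter 3 (1 - 3 t), measured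
  along the primitive integral directions of their edges.  There is a McNaughton homeomorphism
  (the twist) which, for t < 1/4, translates each such leaf along itself by t.  For irrational t this
  is an irrational rotation, hence has dense orbits, while the leaves of rational level lie in
  countably many rational lines and are null.  Therefore an invariant measure is locally invariant
  under translations along the leaves.  Mirroring the square at x = 1/2 yields a second foliation,
  transversal to the first on a small box, where the measure is then translation invariant in two
  directions, i.e. proportional to Lebesgue measure.  The images of this box under the group cover
  the square up to countably many rational lines, so the proportionality is global.
*)

theory Submission
  imports Defs
begin

subsection \<open>Rational complexes from line arrangements\<close>

text \<open>Neither the amount \<open>t\<close> of the rotation nor the bound 1/4 is arbitrary.
  Translating the leaf of level \<open>t\<close> by \<open>t\<close> is integral in the coordinates;
  it is the identity for \<open>t = 0\<close>, so it extends by the identity beyond the hypotenuse;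
  and at \<open>t = 1/4\<close> it moves by exactly one edge, because \<open>t = 1 - 3 * t\<close>
  there, so it continues into the core as the affine rotation of order three. The twist is obtained
  as a product of two reflections, each a piecewise integral involution of determinant -1, and
  invariance is only ever applied to such involutions. Density of orbits does not give invariance at
  once: no single power of the twist approximates a given translation on all levels. The power is
  chosen level by level, in a measurable way and with error \<open>e\<close>, and \<open>e\<close>
  then tends to 0. Since only rational lines are known to be null, boxes are split at rational
  places only, and monotonicity fills the gaps. Lebesgue measure is treated on a par with the given
  measure: any two measures with the same few properties are proportional on a box, and equal total
  mass fixes the constant.\<close>

type_synonym form = "int \<times> int \<times> int"

fun form_at :: "form \<Rightarrow> real^2 \<Rightarrow> real" where
  "form_at (a, b, c) p = of_int a * p $ 1 + of_int b * p $ 2 + of_int c"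

fun neg_form :: "form \<Rightarrow> form" where
  "neg_form (a, b, c) = (- a, - b, - c)"

lemma form_at_neg [simp]: "form_at (neg_form h) p = - form_at h p"
  by (cases h) simp

lemma neg_form_neg [simp]: "neg_form (neg_form h) = h"
  by (cases h) simp

lemma form_at_affine:
  assumes "u + v = 1"
  shows "form_at h (u *\<^sub>R p + v *\<^sub>R q) = u * form_at h p + v * form_at h q"
proof -
  obtain a b c where h: "h = (a, b, c)" by (cases h)
  have "of_int c = (u + v) * (of_int c :: real)" using assms by simp
  then show ?thesis by (simp add: h algebra_simps)
qed

lemma form_at_extend:
  "form_at h (p + e *\<^sub>R (p - q)) = form_at h p + e * (form_at h p - form_at h q)"
  by (cases h) (simp add: algebra_simps)

lemma continuous_on_form_at [continuous_intros]: "continuous_on S (form_at h)"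
proof -
  obtain a b c where h: "h = (a, b, c)" by (cases h)
  have "form_at h = (\<lambda>p. of_int a * p $ 1 + of_int b * p $ 2 + of_int c)" by (auto simp: h)
  then show ?thesis by (auto intro!: continuous_intros)
qed

definition form_region :: "form set \<Rightarrow> (real^2) set" where
  "form_region A = {p. \<forall>h\<in>A. 0 \<le> form_at h p}"

definition square_forms :: "form set" where
  "square_forms = {(1, 0, 0), (-1, 0, 1), (0, 1, 0), (0, -1, 1)}"

lemma mem_unit_square: "p \<in> unit_square \<longleftrightarrow> 0 \<le> p $ 1 \<and> p $ 1 \<le> 1 \<and> 0 \<le> p $ 2 \<and> p $ 2 \<le> 1"
  by (auto simp: mem_box_cart forall_2)

lemma form_region_square: "form_region square_forms = unit_square"
  by (auto simp: form_region_def square_forms_def mem_unit_square)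

lemma form_region_Un: "form_region (A \<union> B) = form_region A \<inter> form_region B"
  by (auto simp: form_region_def)

lemma form_region_antimono: "A \<subseteq> B \<Longrightarrow> form_region B \<subseteq> form_region A"
  by (auto simp: form_region_def)

lemma closed_form_region: "closed (form_region A)"
proof -
  have "form_region A = (\<Inter>h\<in>A. {p. 0 \<le> form_at h p})" by (auto simp: form_region_def)
  moreover have "closed {p. 0 \<le> form_at h p}" for h
    by (intro closed_Collect_le continuous_on_const continuous_on_form_at)
  ultimately show ?thesis by auto
qed

lemma convex_form_region: "convex (form_region A)"
  by (auto simp: convex_def form_region_def form_at_affine)

lemma polyhedron_form_region:
  assumes "finite A"
  shows "polyhedron (form_region A)"
proof -
  have "polyhedron {p. 0 \<le> form_at h p}" for h
  proof -
    obtain a b c where h: "h = (a, b, c)" by (cases h)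
    have "{p. 0 \<le> form_at h p} = {p. (vector [of_int a, of_int b] :: real^2) \<bullet> p \<ge> - of_int c}"
      by (auto simp: h inner_vec_def sum_2)
    then show ?thesis by (metis polyhedron_halfspace_ge)
  qed
  moreover have "form_region A = \<Inter> ((\<lambda>h. {p. 0 \<le> form_at h p}) ` A)"
    by (auto simp: form_region_def)
  ultimately show ?thesis using assms by (metis (no_types, lifting) finite_imageI image_iff polyhedron_Inter)
qed

lemma polytope_form_region:
  assumes "finite A" "square_forms \<subseteq> A"
  shows "polytope (form_region A)"
  using polyhedron_form_region[OF assms(1)] form_region_antimono[OF assms(2)] 
  by (metis form_region_square bounded_cbox bounded_subset polytope_eq_bounded_polyhedron)

text \<open>Constraints with slack survive some positive step, tight ones do not decrease along
  \<open>g\<close>, and finitely many positive steps have a positive minimum. This serves to push a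
  point of a region slightly past itself.\<close>

lemma small_extension:
  assumes "finite A" "\<And>h. h \<in> A \<Longrightarrow> 0 \<le> f h" "\<And>h. h \<in> A \<Longrightarrow> f h = 0 \<Longrightarrow> 0 \<le> g h"
  shows "\<exists>e>0. \<forall>h\<in>A. 0 \<le> f h + e * (g h :: real)"
  using assms
proof (induction A rule: finite_induct)
  case empty
  show ?case by (auto intro: exI[of _ 1])
next
  case (insert h A)
  then obtain e where e: "e > 0" "\<forall>k\<in>A. 0 \<le> f k + e * g k" by auto
  obtain d where d: "d > 0" "0 \<le> f h + d * g h"
  proof (cases "0 \<le> g h")
    case True
    then show ?thesis using that[of 1] insert.prems(1)[of h] by simp
  next
    case False
    then have "f h > 0" using insert.prems(1,2)[of h] by force
    then show ?thesis using that[of "f h / - g h"] False by (simp add: field_simps)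
  qed
  \<comment> \<open>An affine function that is nonnegative at 0 and at \<open>c\<close> is
    nonnegative at every step in between.\<close>
  have between: "0 \<le> x + min e d * y" if "0 \<le> x" "0 \<le> x + c * y" "min e d \<le> c" for x y c :: real
  proof (cases "0 \<le> y")
    case True
    then show ?thesis using that e d by simp
  next
    case False
    then have "c * y \<le> min e d * y" using that(3) by (intro mult_right_mono_neg) auto
    then show ?thesis using that(2) by linarith
  qed
  show ?case
  proof (intro exI[of _ "min e d"] conjI ballI)
    show "min e d > 0" using e d by simp
    fix k assume "k \<in> insert h A"
    then show "0 \<le> f k + min e d * g k"
      using between[of "f k" e "g k"] between[of "f k" d "g k"] e d insert.prems(1)[of k] by auto
  qed
qed

lemma rational_solution_2x2:
  fixes x y :: real
  assumes "a * d - b * c \<noteq> 0" "of_int a * x + of_int b * y + of_int e = 0"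
    "of_int c * x + of_int d * y + of_int f = 0"
  shows "x \<in> \<rat>" "y \<in> \<rat>"
proof -
  have D: "of_int (a * d - b * c) \<noteq> (0::real)" using assms(1) of_int_eq_0_iff by blast
  have "x * of_int (a * d - b * c) = of_int (b * f - e * d)"
    using assms(2,3) by simp algebra
  then have "x = of_int (b * f - e * d) / of_int (a * d - b * c)" using D by (simp add: field_simps)
  then show "x \<in> \<rat>" by (metis Rats_divide Rats_of_int)
  have "y * of_int (a * d - b * c) = of_int (c * e - a * f)"
    using assms(2,3) by simp algebra
  then have "y = of_int (c * e - a * f) / of_int (a * d - b * c)" using D by (simp add: field_simps)
  then show "y \<in> \<rat>" by (metis Rats_divide Rats_of_int)
qed

text \<open>If the gradients of the forms tight at \<open>v\<close> did not span the plane,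
  \<open>v\<close> could move both ways along a common null direction without leaving the region. So
  two tight forms have nonzero determinant, and Cramer's rule gives rational coordinates.\<close>

lemma extreme_point_form_region_rational:
  assumes "finite A" and v: "v extreme_point_of form_region A"
  shows "v $ i \<in> \<rat>"
proof -
  have vA: "\<And>h. h \<in> A \<Longrightarrow> 0 \<le> form_at h v"
    and ext: "\<And>a b. a \<in> form_region A \<Longrightarrow> b \<in> form_region A \<Longrightarrow> v \<notin> open_segment a b"
    using v by (auto simp: extreme_point_of_def form_region_def)
  define Z where "Z = {h \<in> A. form_at h v = 0}"
  have no_dir: False if "d \<noteq> 0" "\<And>a b c. (a, b, c) \<in> Z \<Longrightarrow> of_int a * d $ 1 + of_int b * d $ 2 = 0" for d :: "real^2"
  proof -
    define g where "g h = form_at h (v + d) - form_at h v" for h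
    have g: "form_at h (v + e *\<^sub>R d) = form_at h v + e * g h" for h e
      by (cases h) (simp add: g_def algebra_simps)
    have g0: "g h = 0" if "h \<in> Z" for h
      using that(1) \<open>\<And>a b c. (a, b, c) \<in> Z \<Longrightarrow> of_int a * d $ 1 + of_int b * d $ 2 = 0\<close>
      by (cases h) (auto simp: g_def algebra_simps)
    obtain e where e: "e > 0" "\<forall>h\<in>A. 0 \<le> form_at h v + e * g h"
      using small_extension[of A "\<lambda>h. form_at h v" g] assms(1) vA g0 by (auto simp: Z_def)
    obtain e' where e': "e' > 0" "\<forall>h\<in>A. 0 \<le> form_at h v + e' * (- g h)"
      using small_extension[of A "\<lambda>h. form_at h v" "\<lambda>h. - g h"] assms(1) vA g0 by (auto simp: Z_def)
    have in1: "v + e *\<^sub>R d \<in> form_region A" using e by (simp add: form_region_def g)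
    have in2: "v + (- e') *\<^sub>R d \<in> form_region A" using e' g[of _ "- e'"] by (simp add: form_region_def)
    have "v = (1 - e / (e + e')) *\<^sub>R (v + e *\<^sub>R d) + (e / (e + e')) *\<^sub>R (v + (- e') *\<^sub>R d)"
    proof -
      have "(1 - w) *\<^sub>R (v + e *\<^sub>R d) + w *\<^sub>R (v + (- e') *\<^sub>R d) = v + ((1 - w) * e - w * e') *\<^sub>R d" for w
        by (simp add: algebra_simps)
      moreover have "(1 - e / (e + e')) * e - (e / (e + e')) * e' = 0" using e(1) e'(1) by (simp add: field_simps)
      ultimately show ?thesis by simp
    qed
    moreover have "0 < e / (e + e')" "e / (e + e') < 1" using e(1) e'(1) by (auto simp: field_simps)
    moreover have "v + e *\<^sub>R d \<noteq> v + (- e') *\<^sub>R d"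
    proof
      assume "v + e *\<^sub>R d = v + (- e') *\<^sub>R d"
      then have "(e + e') *\<^sub>R d = 0" by (simp add: algebra_simps)
      then show False using that(1) e(1) e'(1) by simp
    qed
    ultimately have "v \<in> open_segment (v + e *\<^sub>R d) (v + (- e') *\<^sub>R d)"
      unfolding in_segment by blast
    then show False using ext[OF in1 in2] by blast
  qed
  have "\<exists>a b c. (a, b, c) \<in> Z \<and> (a \<noteq> 0 \<or> b \<noteq> 0)"
  proof (rule ccontr)
    assume "\<not> ?thesis"
    then have "a = 0 \<and> b = 0" if "(a, b, c) \<in> Z" for a b c using that by blast
    then have "of_int a * (1::real^2) $ 1 + of_int b * (1::real^2) $ 2 = 0" if "(a, b, c) \<in> Z" for a b c
      using that by fastforce
    then show False using no_dir[of 1] by simp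
  qed
  then obtain a b c where abc: "(a, b, c) \<in> Z" "a \<noteq> 0 \<or> b \<noteq> 0" by blast
  have "\<exists>a' b' c'. (a', b', c') \<in> Z \<and> a * b' - b * a' \<noteq> 0"
  proof (rule ccontr)
    assume c: "\<not> ?thesis"
    have "of_int a' * - of_int b + of_int b' * (of_int a :: real) = 0" if "(a', b', c') \<in> Z" for a' b' c'
    proof -
      have "a * b' - b * a' = 0" using c that by blast
      then have "of_int (a * b' - b * a') = (0::real)" by simp
      then show ?thesis by (simp add: algebra_simps)
    qed
    \<comment> \<open>The direction of the line of \<open>(a, b, c)\<close>, annihilated by every
      gradient parallel to \<open>(a, b)\<close>.\<close>
    moreover have "(vector [- of_int b, of_int a] :: real^2) \<noteq> 0"
      using abc(2) by (auto simp: vec_eq_iff forall_2)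
    ultimately show False using no_dir[of "vector [- of_int b, of_int a]"] by auto
  qed
  then obtain a' b' c' where abc': "(a', b', c') \<in> Z" "a * b' - b * a' \<noteq> 0" by blast
  have "v $ 1 \<in> \<rat>" "v $ 2 \<in> \<rat>"
    using rational_solution_2x2[of a b' b a' "v $ 1" "v $ 2" c c'] abc abc' by (auto simp: Z_def)
  then show ?thesis using exhaust_2[of i] by auto
qed

locale arrangement =
  fixes H :: "form set"
  assumes finite_H: "finite H" and square_H: "square_forms \<subseteq> H"
    and neg_H: "h \<in> H \<Longrightarrow> neg_form h \<in> H"
begin

text \<open>Both \<open>h\<close> and \<open>neg_form h\<close> may be chosen, which confines the
  region to a line; so lower-dimensional faces are cells of the same kind.\<close>

definition sign_choices :: "form set set" where
  "sign_choices = {A. square_forms \<subseteq> A \<and> A \<subseteq> H \<and> (\<forall>h\<in>H. h \<in> A \<or> neg_form h \<in> A)}"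

definition cells :: "(real^2) set set" where
  "cells = insert {} (form_region ` sign_choices)"

lemma finite_cells: "finite cells"
proof -
  have "sign_choices \<subseteq> Pow H" by (auto simp: sign_choices_def)
  then show ?thesis unfolding cells_def using finite_H by (meson finite_Pow_iff finite_imageI finite_insert finite_subset)
qed

lemma Union_cells: "\<Union> cells = unit_square"
proof
  show "\<Union> cells \<subseteq> unit_square"
    using form_region_antimono[of square_forms] by (auto simp: cells_def sign_choices_def form_region_square)
  show "unit_square \<subseteq> \<Union> cells"
  proof
    fix p :: "real^2" assume p: "p \<in> unit_square"
    define A where "A = {h \<in> H. 0 \<le> form_at h p}"
    have "A \<in> sign_choices" 
      using p square_H neg_H by (auto simp: sign_choices_def A_def form_region_square[symmetric] form_region_def)
    moreover have "p \<in> form_region A" by (simp add: form_region_def A_def)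
    ultimately show "p \<in> \<Union> cells" by (auto simp: cells_def)
  qed
qed

lemma sign_choices_Un: "A \<in> sign_choices \<Longrightarrow> B \<subseteq> H \<Longrightarrow> A \<union> B \<in> sign_choices"
  by (auto simp: sign_choices_def)

text \<open>A nonempty face is cut out by turning into equations all forms tight at one of its
  relative interior points \<open>x\<close>. From a point of the face one can go a bit past
  \<open>x\<close> inside the face, so these forms vanish at that point. Conversely, from a point
  satisfying the equations one can go past \<open>x\<close> inside the cell, and the face property
  pulls the point into \<open>F\<close>.\<close>

lemma face_of_cell:
  assumes A: "A \<in> sign_choices" and F: "F face_of form_region A"
  shows "F \<in> cells"
proof (cases "F = {}")
  case False
  have cF: "convex F" and FA: "F \<subseteq> form_region A" using F by (auto simp: face_of_def)
  obtain x where x: "x \<in> rel_interior F" using rel_interior_eq_empty[OF cF] False by blast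
  then have xF: "x \<in> F" using rel_interior_subset by blast
  define Z where "Z = neg_form ` {h \<in> A. form_at h x = 0}"
  have Z: "Z \<subseteq> H" using A neg_H by (auto simp: Z_def sign_choices_def)
  have finA: "finite A" using A finite_H finite_subset by (auto simp: sign_choices_def)
  have "F = form_region (A \<union> Z)"
  proof
    show "F \<subseteq> form_region (A \<union> Z)"
    proof
      fix y assume y: "y \<in> F"
      have "form_at h y = 0" if h: "h \<in> A" "form_at h x = 0" for h
      proof -
        obtain e where e: "e > 1" "(1 - e) *\<^sub>R y + e *\<^sub>R x \<in> F"
          using y x convex_rel_interior_iff[OF cF False, of x] by blast
        have "0 \<le> form_at h ((1 - e) *\<^sub>R y + e *\<^sub>R x)" using e FA h by (auto simp: form_region_def)
        then have "0 \<le> (1 - e) * form_at h y" using h by (simp add: form_at_affine)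
        moreover have "0 \<le> form_at h y" using y FA h by (auto simp: form_region_def)
        ultimately show ?thesis using e(1) by (simp add: zero_le_mult_iff)
      qed
      then have "form_at h y = 0" if hZ: "neg_form h \<in> Z" for h
      proof -
        obtain k where "neg_form h = neg_form k" "k \<in> A" "form_at k x = 0"
          using hZ unfolding Z_def by blast
        then show ?thesis
          using \<open>\<And>h. h \<in> A \<Longrightarrow> form_at h x = 0 \<Longrightarrow> form_at h y = 0\<close>[of k] neg_form_neg by metis
      qed
      then have "y \<in> form_region Z"
        unfolding form_region_def
      proof (intro CollectI ballI)
        fix k assume "k \<in> Z"
        then have "form_at (neg_form k) y = 0"
          using \<open>\<And>h. neg_form h \<in> Z \<Longrightarrow> form_at h y = 0\<close>[of "neg_form k"] by (simp only: neg_form_neg)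
        then show "0 \<le> form_at k y" by simp
      qed
      then show "y \<in> form_region (A \<union> Z)" using y FA by (auto simp: form_region_Un)
    qed
    show "form_region (A \<union> Z) \<subseteq> F"
    proof
      fix y assume y: "y \<in> form_region (A \<union> Z)"
      have zero: "form_at h y = 0" if "h \<in> A" "form_at h x = 0" for h
      proof -
        have "0 \<le> form_at h y" "0 \<le> form_at (neg_form h) y"
          using y that unfolding form_region_def Z_def by blast+
        then show ?thesis by simp
      qed
      obtain e where e: "e > 0" "\<forall>h\<in>A. 0 \<le> form_at h x + e * (form_at h x - form_at h y)"
      proof -
        have "0 \<le> form_at h x" if "h \<in> A" for h
          using that xF FA unfolding form_region_def by blast
        moreover have "0 \<le> form_at h x - form_at h y" if "h \<in> A" "form_at h x = 0" for h
          using that(2) zero[OF that] by simp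
        ultimately show ?thesis
          using that small_extension[OF finA, of "\<lambda>h. form_at h x" "\<lambda>h. form_at h x - form_at h y"] by blast
      qed
      define w where "w = x + e *\<^sub>R (x - y)"
      have w: "w \<in> form_region A" using e by (simp add: form_region_def form_at_extend w_def)
      show "y \<in> F"
      proof (cases "y = x")
        case False
        have "x = (1 - 1 / (1 + e)) *\<^sub>R y + (1 / (1 + e)) *\<^sub>R w"
        proof -
          have "(1 - k) *\<^sub>R y + k *\<^sub>R w = y + (k * (1 + e)) *\<^sub>R (x - y)" for k
            by (simp add: w_def algebra_simps)
          then show ?thesis using e(1) by simp
        qed
        moreover have "0 < 1 / (1 + e)" "1 / (1 + e) < 1" using e(1) by auto
        moreover have "y \<noteq> w"
        proof
          assume "y = w"
          then have "(1 + e) *\<^sub>R (x - y) = 0" by (simp add: w_def algebra_simps)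
          then show False using False e(1) by simp
        qed
        ultimately have "x \<in> open_segment y w" unfolding in_segment by blast
        then show ?thesis using F xF w y unfolding face_of_def form_region_Un by blast
      qed (use xF in simp)
    qed
  qed
  then show ?thesis using sign_choices_Un[OF A Z] by (auto simp: cells_def)
qed (simp add: cells_def)

text \<open>If a form is chosen by \<open>B\<close> but not by \<open>A\<close>, its negative is
  chosen by \<open>A\<close>. The form is then nonpositive at the ends of the segment and
  nonnegative at an inner point, hence zero at both ends.\<close>

lemma Int_face_of_cell:
  assumes A: "A \<in> sign_choices" and B: "B \<in> sign_choices"
  shows "(form_region A \<inter> form_region B) face_of form_region A"
  unfolding face_of_def
proof (intro conjI ballI impI)
  show "convex (form_region A \<inter> form_region B)" by (intro convex_Int convex_form_region)
  fix a b x assume ab: "a \<in> form_region A" "b \<in> form_region A"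
    and x: "x \<in> form_region A \<inter> form_region B" "x \<in> open_segment a b"
  obtain u where u: "0 < u" "u < 1" "x = (1 - u) *\<^sub>R a + u *\<^sub>R b" using x(2) by (auto simp: in_segment)
  have "0 \<le> form_at h a \<and> 0 \<le> form_at h b" if h: "h \<in> B" for h
  proof (cases "h \<in> A")
    case True
    then show ?thesis using ab by (auto simp: form_region_def)
  next
    case False
    then have "neg_form h \<in> A" using A B h by (auto simp: sign_choices_def)
    then have "0 \<le> form_at (neg_form h) a" "0 \<le> form_at (neg_form h) b"
      using ab unfolding form_region_def by blast+
    then have neg: "form_at h a \<le> 0" "form_at h b \<le> 0" by auto
    have "0 \<le> form_at h x" using x(1) h by (auto simp: form_region_def)
    then have s: "0 \<le> (1 - u) * form_at h a + u * form_at h b" using u by (simp add: form_at_affine)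
    have "(1 - u) * form_at h a \<le> 0" "u * form_at h b \<le> 0"
      using neg u by (auto simp: mult_le_0_iff)
    then have "(1 - u) * form_at h a = 0" "u * form_at h b = 0" using s by linarith+
    then show ?thesis using u by simp
  qed
  then show "a \<in> form_region A \<inter> form_region B" "b \<in> form_region A \<inter> form_region B"
    using ab by (auto simp: form_region_def)
qed auto

lemma rational_square_complex_cells: "rational_square_complex cells"
proof -
  have fin: "finite A" if "A \<in> sign_choices" for A
    using that finite_H finite_subset by (auto simp: sign_choices_def)
  have "polytope C \<and> (\<forall>v. v extreme_point_of C \<longrightarrow> (\<forall>i. v $ i \<in> \<rat>))" if "C \<in> cells" for C
    using that fin extreme_point_form_region_rational polytope_form_region
    by (auto simp: cells_def sign_choices_def extreme_point_of_empty polytope_empty)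
  moreover have "F \<in> cells" if "C \<in> cells" "F face_of C" for C F
    using that face_of_cell by (auto simp: cells_def)
  moreover have "(C \<inter> D) face_of C" if "C \<in> cells" "D \<in> cells" for C D
    using that Int_face_of_cell by (auto simp: cells_def empty_face_of)
  ultimately show ?thesis
    unfolding rational_square_complex_def rational_complex_def
    using finite_cells Union_cells by (metis Int_commute)
qed

text \<open>If a form of \<open>B\<close> is nonpositive on \<open>C\<close>, it vanishes at
  \<open>x\<close>. Going from \<open>y\<close> slightly past the interior point \<open>x\<close>
  stays in \<open>C\<close> and reverses the sign, so the form is also nonnegative at
  \<open>y\<close>.\<close>

lemma full_cell_subset_region:
  assumes C: "C \<in> cells" "aff_dim C = 2" and x: "x \<in> interior C" "x \<in> form_region B" and B: "B \<subseteq> H"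
  shows "C \<subseteq> form_region B"
proof -
  obtain A where A: "A \<in> sign_choices" "C = form_region A" using C x by (auto simp: cells_def)
  have "0 \<le> form_at h y" if h: "h \<in> B" and y: "y \<in> C" for h y
  proof (cases "h \<in> A")
    case True
    then show ?thesis using y A by (auto simp: form_region_def)
  next
    case False
    then have nA: "neg_form h \<in> A" using A B h by (auto simp: sign_choices_def)
    have nonpos: "form_at h q \<le> 0" if "q \<in> C" for q
    proof -
      have "0 \<le> form_at (neg_form h) q" using that nA A(2) unfolding form_region_def by blast
      then show ?thesis by simp
    qed
    obtain r where r: "r > 0" "ball x r \<subseteq> C" using x(1) by (meson mem_interior)
    \<comment> \<open>The step from \<open>x\<close> has length below \<open>r\<close>; the added 1
      avoids a zero denominator when \<open>y = x\<close>.\<close>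
    define e where "e = r / (2 * (norm (x - y) + 1))"
    have e: "e > 0" using r by (simp add: e_def add_nonneg_pos)
    have "norm (e *\<^sub>R (x - y)) < r"
    proof -
      have "norm (e *\<^sub>R (x - y)) = (r / 2) * (norm (x - y) / (norm (x - y) + 1))" using r e by (simp add: e_def)
      also have "\<dots> \<le> (r / 2) * 1"
      proof (intro mult_left_mono)
        show "norm (x - y) / (norm (x - y) + 1) \<le> 1"
          by (simp add: divide_le_eq_1 add_nonneg_pos)
      qed (use r in auto)
      also have "\<dots> < r" using r by simp
      finally show ?thesis .
    qed
    then have "x + e *\<^sub>R (x - y) \<in> C" using r by (auto simp: dist_norm)
    then have "form_at h x + e * (form_at h x - form_at h y) \<le> 0"
      using nonpos[of "x + e *\<^sub>R (x - y)"] by (simp add: form_at_extend)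
    moreover have "form_at h x = 0"
      using x h nonpos[of x] interior_subset[of C] by (force simp: form_region_def)
    ultimately have "0 \<le> e * form_at h y" by simp
    then show ?thesis using e by (simp add: zero_le_mult_iff)
  qed
  then show ?thesis by (auto simp: form_region_def)
qed

end

text \<open>Provides the complexes for both McNaughton notions from a finite cover by integral
  regions, which may overlap and need not meet in faces. All their lines together form an
  arrangement, and a full cell lies in any region that contains one of its interior points.\<close>

lemma complex_refining_regions:
  assumes fin: "finite \<R>" "\<And>B. B \<in> \<R> \<Longrightarrow> finite B"
    and cover: "unit_square \<subseteq> (\<Union>B\<in>\<R>. form_region B)"
  obtains K where "rational_square_complex K" "\<And>C. C \<in> K \<Longrightarrow> aff_dim C = 2 \<Longrightarrow> \<exists>B\<in>\<R>. C \<subseteq> form_region B"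
proof -
  define H where "H = (square_forms \<union> \<Union>\<R>) \<union> neg_form ` (square_forms \<union> \<Union>\<R>)"
  interpret arrangement H
  proof
    show "finite H" using fin by (simp add: H_def square_forms_def)
  qed (auto simp: H_def)
  have "\<exists>B\<in>\<R>. C \<subseteq> form_region B" if C: "C \<in> cells" "aff_dim C = 2" for C
  proof -
    have "C \<noteq> {}" using C(2) by auto
    moreover have "convex C" using C(1) convex_form_region by (auto simp: cells_def)
    ultimately have "interior C \<noteq> {}"
      using C(2) by (simp add: interior_rel_interior_gen rel_interior_eq_empty)
    then obtain x where x: "x \<in> interior C" by blast
    then have "x \<in> unit_square" using C Union_cells interior_subset by blast
    then obtain B where "B \<in> \<R>" "x \<in> form_region B" using cover by blast
    then show ?thesis using full_cell_subset_region[OF C x] by (auto simp: H_def)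
  qed
  then show ?thesis using that rational_square_complex_cells by blast
qed

subsection \<open>Piecewise integral affine involutions\<close>

fun form_det :: "form \<Rightarrow> form \<Rightarrow> int" where
  "form_det (a, b, c) (d, e, f) = a * e - b * d"

definition form_pair :: "form \<Rightarrow> form \<Rightarrow> real^2 \<Rightarrow> real^2" where
  "form_pair u v p = vector [form_at u p, form_at v p]"

fun form_matrix :: "form \<Rightarrow> form \<Rightarrow> int^3^3" where
  "form_matrix (a, b, c) (d, e, f) = vector [vector [a, b, c], vector [d, e, f], vector [0, 0, 1]]"

lemma det_form_matrix: "det (form_matrix u v) = form_det u v"
  by (cases u; cases v) (simp add: det_3)

lemma form_matrix_last_row: "form_matrix u v $ 3 = vector [0, 0, 1]"
  by (cases u; cases v) simp

lemma homogeneous_form_pair: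
  "homogeneous (form_pair u v p) = map_matrix of_int (form_matrix u v) *v homogeneous p"
  by (cases u; cases v)
    (simp add: homogeneous_def form_pair_def vec_eq_iff forall_3 matrix_vector_mult_def sum_3 map_matrix_def)

lemma continuous_on_form_pair: "continuous_on X (form_pair u v)"
proof -
  have "form_pair u v = (\<lambda>p. \<chi> i. if i = 1 then form_at u p else form_at v p)"
    by (auto simp: form_pair_def vec_eq_iff forall_2)
  moreover have "continuous_on X (\<lambda>p. if i = 1 then form_at u p else form_at v p)" for i :: 2
    by (cases "i = 1") (auto intro: continuous_on_form_at)
  ultimately show ?thesis by (auto intro!: continuous_on_vec_lambda)
qed

lemma emeasure_form_pair_image:
  assumes det: "\<bar>form_det u v\<bar> = 1" and Y: "Y \<in> lmeasurable"
  shows "form_pair u v ` Y \<in> lmeasurable" "emeasure lebesgue (form_pair u v ` Y) = emeasure lebesgue Y"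
proof -
  obtain a b c d e f where uv: "u = (a, b, c)" "v = (d, e, f)" by (cases u; cases v)
  define L where "L = (\<lambda>p :: real^2. vector [of_int a * p $ 1 + of_int b * p $ 2, of_int d * p $ 1 + of_int e * p $ 2] :: real^2)"
  have L: "linear L"
    by (rule linearI) (auto simp: L_def vec_eq_iff forall_2 algebra_simps)
  have img: "form_pair u v ` Y = (+) (vector [of_int c, of_int f]) ` L ` Y"
    unfolding image_image
    by (intro image_cong refl) (auto simp: form_pair_def L_def uv vec_eq_iff forall_2)
  have "det (matrix L) = of_int (form_det u v)"
    by (simp add: det_2 matrix_def L_def uv axis_def)
  then have detL: "\<bar>det (matrix L)\<bar> = 1" using det by (metis of_int_1 of_int_abs)
  have LY: "L ` Y \<in> lmeasurable" using measurable_linear_image[OF L Y] .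
  then show img_meas: "form_pair u v ` Y \<in> lmeasurable" unfolding img by (rule measurable_translation)
  have "measure lebesgue (form_pair u v ` Y) = measure lebesgue Y"
    unfolding img measure_translation using measure_linear_image[OF L Y] detL by simp
  then show "emeasure lebesgue (form_pair u v ` Y) = emeasure lebesgue Y"
    using img_meas Y by (simp add: emeasure_eq_measure2)
qed

text \<open>A self-inverse map needs no second map to witness a homeomorphism, and the fixed
  determinant -1 settles the common sign. Agreement with every applicable piece, not just one, is
  what gives continuity across overlaps.\<close>

locale unimodular_involution =
  fixes ps :: "(form set \<times> form \<times> form) set" and S :: "real^2 \<Rightarrow> real^2"
  assumes finite_ps: "finite ps"
    and finite_region: "(B, u, v) \<in> ps \<Longrightarrow> finite B"
    and det_piece: "(B, u, v) \<in> ps \<Longrightarrow> form_det u v = -1"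
    and piece: "(B, u, v) \<in> ps \<Longrightarrow> p \<in> form_region B \<Longrightarrow> p \<in> unit_square \<Longrightarrow> S p = form_pair u v p"
    and cover: "p \<in> unit_square \<Longrightarrow> \<exists>(B, u, v) \<in> ps. p \<in> form_region B"
    and into_square: "p \<in> unit_square \<Longrightarrow> S p \<in> unit_square"
    and involution: "p \<in> unit_square \<Longrightarrow> S (S p) = p"
begin

lemma continuous: "continuous_on unit_square S"
proof -
  have "continuous_on (\<Union>b\<in>ps. form_region (fst b) \<inter> unit_square) S"
  proof (intro continuous_on_closed_Union[OF finite_ps])
    fix b assume "b \<in> ps"
    then obtain B u v where b: "b = (B, u, v)" "(B, u, v) \<in> ps" by (cases b) auto
    then show "closed (form_region (fst b) \<inter> unit_square)" by (auto intro: closed_form_region)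
    show "continuous_on (form_region (fst b) \<inter> unit_square) S"
      using continuous_on_form_pair by (rule continuous_on_eq) (use b piece in auto)
  qed
  moreover have "(\<Union>b\<in>ps. form_region (fst b) \<inter> unit_square) = unit_square"
    using cover by force
  ultimately show ?thesis by simp
qed

lemma mcnaughton: "mcnaughton_homeomorphism S"
proof -
  have "S ` unit_square = unit_square" using into_square involution by force
  then have hom: "homeomorphism unit_square unit_square S S"
    by (simp add: homeomorphism_def continuous involution)
  obtain K where K: "rational_square_complex K"
    "\<And>C. C \<in> K \<Longrightarrow> aff_dim C = 2 \<Longrightarrow> \<exists>B\<in>fst ` ps. C \<subseteq> form_region B"
  proof (rule complex_refining_regions[of "fst ` ps"])
    show "unit_square \<subseteq> (\<Union>B\<in>fst ` ps. form_region B)" using cover by force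
  qed (use finite_ps finite_region in auto)
  have "\<exists>b\<in>ps. C \<subseteq> form_region (fst b)" if "C \<in> K" "aff_dim C = 2" for C
    using K(2)[OF that] by auto
  then obtain b where b: "\<And>C. C \<in> K \<Longrightarrow> aff_dim C = 2 \<Longrightarrow> b C \<in> ps \<and> C \<subseteq> form_region (fst (b C))"
    by metis
  define P where "P C = form_matrix (fst (snd (b C))) (snd (snd (b C)))" for C
  have sub: "C \<subseteq> unit_square" if "C \<in> K" for C
    using K(1) that by (auto simp: rational_square_complex_def)
  show ?thesis unfolding mcnaughton_homeomorphism_def
  proof (intro conjI exI[of _ S] exI[of _ K] exI[of _ P] disjI2 ballI impI)
    fix C assume C: "C \<in> K" "aff_dim C = 2"
    obtain B u v where B: "b C = (B, u, v)" "(B, u, v) \<in> ps" "C \<subseteq> form_region B"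
      using b[OF C] by (cases "b C") auto
    show "P C $ 3 = vector [0, 0, 1]" by (simp add: P_def form_matrix_last_row)
    show "det (P C) = -1" using det_piece[OF B(2)] by (simp add: P_def B det_form_matrix)
    show "homogeneous (S x) = map_matrix of_int (P C) *v homogeneous x" if x: "x \<in> C" for x
    proof -
      have "S x = form_pair u v x" using piece[OF B(2), of x] x B(3) sub[OF C(1)] by blast
      then show ?thesis by (simp add: P_def B(1) homogeneous_form_pair)
    qed
  qed (use hom K in auto)
qed

lemma preimage_sets:
  assumes "A \<in> sets borel"
  shows "S -` A \<inter> unit_square \<in> sets borel"
proof -
  have "S \<in> borel_measurable (restrict_space borel unit_square)"
    using continuous by (rule borel_measurable_continuous_on_restrict)
  then have "S -` A \<inter> space (restrict_space borel unit_square) \<in> sets (restrict_space borel unit_square)"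
    using assms by (rule measurable_sets)
  then show ?thesis by (simp add: space_restrict_space sets_restrict_space_iff)
qed

text \<open>The preimage is cut into disjoint parts on each of which \<open>S\<close> is affine and
  unimodular. The images of the parts are disjoint by injectivity and lie in \<open>A\<close>, so
  the volumes add up to at most that of \<open>A\<close>.\<close>

lemma emeasure_lborel_preimage_le:
  assumes A: "A \<in> sets borel" "A \<subseteq> unit_square"
  shows "emeasure lborel (S -` A \<inter> unit_square) \<le> emeasure lborel A"
proof -
  obtain b :: "nat \<Rightarrow> _" and n where b: "ps = b ` {..<n}"
    using finite_ps by (metis finite_imp_nat_seg_image_inj_on lessThan_def)
  define X where "X = S -` A \<inter> unit_square"
  define D where "D = disjointed (\<lambda>i. form_region (fst (b i)))"
  define Y where "Y i = X \<inter> D i" for i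
  have X: "X \<in> sets borel" unfolding X_def by (rule preimage_sets[OF A(1)])
  have D: "D i \<in> sets borel" for i
    unfolding D_def
    by (rule sets.range_disjointed_sets'[THEN subsetD, OF _ rangeI]) (auto intro: borel_closed closed_form_region)
  have Xsq: "X \<subseteq> unit_square" by (auto simp: X_def)
  have Y: "Y i \<in> lmeasurable" for i
  proof -
    have "Y i \<in> sets lebesgue" using X D by (auto simp: Y_def)
    moreover have "Y i \<subseteq> unit_square" using Xsq by (auto simp: Y_def)
    ultimately show ?thesis by (metis lmeasurable_cbox fmeasurableI2)
  qed
  have XY: "X = (\<Union>i<n. Y i)"
  proof
    show "X \<subseteq> (\<Union>i<n. Y i)"
    proof
      fix x assume x: "x \<in> X"
      obtain j where j: "j < n" "x \<in> form_region (fst (b j))" using cover[of x] x Xsq b by force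
      have "x \<in> (\<Union>i<n. form_region (fst (b i)))" using j by blast
      then have "x \<in> (\<Union>i<n. D i)"
        unfolding D_def by (simp add: finite_UN_disjointed_eq lessThan_atLeast0)
      then show "x \<in> (\<Union>i<n. Y i)" using x by (auto simp: Y_def)
    qed
  qed (auto simp: Y_def)
  have "disjoint_family D" unfolding D_def by (rule disjoint_family_disjointed)
  then have disj: "disjoint_family_on Y {..<n}" by (auto simp: disjoint_family_on_def Y_def)
  have inj: "inj_on S unit_square" by (rule inj_on_inverseI) (rule involution)
  have SY: "S ` Y i \<in> lmeasurable \<and> emeasure lebesgue (S ` Y i) = emeasure lebesgue (Y i)" if "i < n" for i
  proof -
    obtain B u v where B: "b i = (B, u, v)" "(B, u, v) \<in> ps" using b \<open>i < n\<close> by (cases "b i") force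
    have "Y i \<subseteq> form_region B" using disjointed_subset[of "\<lambda>i. form_region (fst (b i))" i] B
      by (auto simp: Y_def D_def)
    then have "S ` Y i = form_pair u v ` Y i"
      using piece[OF B(2)] Xsq by (intro image_cong refl) (auto simp: Y_def)
    then show ?thesis using emeasure_form_pair_image[of u v "Y i"] det_piece[OF B(2)] Y by simp
  qed
  have "emeasure lebesgue X = (\<Sum>i<n. emeasure lebesgue (Y i))"
    unfolding XY by (rule sum_emeasure[symmetric]) (use Y disj in \<open>auto simp: fmeasurableD\<close>)
  also have "\<dots> = (\<Sum>i<n. emeasure lebesgue (S ` Y i))" using SY by simp
  also have "\<dots> = emeasure lebesgue (\<Union>i<n. S ` Y i)"
  proof (rule sum_emeasure)
    have "S ` Y i \<inter> S ` Y j = S ` (Y i \<inter> Y j)" for i j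
      using inj Xsq by (subst inj_on_image_Int[of S unit_square]) (auto simp: Y_def)
    then show "disjoint_family_on (\<lambda>i. S ` Y i) {..<n}" using disj by (auto simp: disjoint_family_on_def)
  qed (use SY in \<open>auto simp: fmeasurableD\<close>)
  also have "\<dots> \<le> emeasure lebesgue A"
    by (rule emeasure_mono) (use A in \<open>auto simp: Y_def X_def\<close>)
  finally show ?thesis using X A by (simp add: X_def)
qed

lemma emeasure_lborel_preimage:
  assumes A: "A \<in> sets borel" "A \<subseteq> unit_square"
  shows "emeasure lborel (S -` A \<inter> unit_square) = emeasure lborel A"
proof (rule antisym)
  show "emeasure lborel (S -` A \<inter> unit_square) \<le> emeasure lborel A"
    using A by (rule emeasure_lborel_preimage_le)
  \<comment> \<open>\<open>A\<close> is the preimage of its own preimage, so the inequality can be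
    used in the other direction.\<close>
  have "A = S -` (S -` A \<inter> unit_square) \<inter> unit_square"
    using A(2) into_square involution by auto
  then show "emeasure lborel A \<le> emeasure lborel (S -` A \<inter> unit_square)"
    using emeasure_lborel_preimage_le[OF preimage_sets[OF A(1)]] by auto
qed

end

subsection \<open>The twist\<close>

definition coord_swap :: "real^2 \<Rightarrow> real^2" where
  "coord_swap p = vector [p $ 2, p $ 1]"

definition mirror :: "real^2 \<Rightarrow> real^2" where
  "mirror p = vector [1 - p $ 1, p $ 2]"

text \<open>With \<open>z = 1 - x - y\<close>, the pieces are, in this order: \<open>z \<le> 0\<close>, where coordinates are swapped; the
  core, where all of \<open>x, y, z\<close> are at least \<open>1/4\<close>, with the reflection exchanging \<open>x\<close> and \<open>z\<close>; and
  two pieces for each of the regions where \<open>y\<close>, \<open>x\<close>, \<open>z\<close> is minimal.  They come from reflecting each leaf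
  of level \<open>t \<le> 1/4\<close> by \<open>s \<mapsto> t - s\<close> in its arc length parameter; at \<open>t = 1/4\<close> this agrees
  with the affine reflection of the core.\<close>

definition leaf_flip_pieces :: "(form set \<times> form \<times> form) set" where
  "leaf_flip_pieces =
    {({(1, 1, -1)}, (0, 1, 0), (1, 0, 0)),
     ({(4, 0, -1), (0, 4, -1), (-4, -4, 3)}, (-1, -1, 1), (0, 1, 0)),
     ({(1, -1, 0), (-1, -2, 1), (-1, 2, 0), (0, -4, 1)}, (-1, 3, 0), (0, 1, 0)),
     ({(-1, -2, 1), (1, -2, 0)}, (0, 1, 0), (1, -1, 0)),
     ({(-1, 1, 0), (-3, -1, 1)}, (1, 1, 0), (1, 0, 0)),
     ({(-1, 1, 0), (-2, -1, 1), (3, 1, -1), (-4, 0, 1)}, (-5, -1, 2), (4, 1, -1)),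
     ({(2, 1, -1), (1, 2, -1), (-2, -3, 2), (4, 4, -3)}, (-1, -1, 1), (4, 5, -3)),
     ({(2, 1, -1), (2, 3, -2), (-1, -1, 1)}, (1, 2, -1), (0, -1, 1))}"

text \<open>Neighbouring pieces overlap; on the square the choice is immaterial by
  \<open>leaf_flip_pieces_agree\<close>.\<close>

definition leaf_flip :: "real^2 \<Rightarrow> real^2" where
  "leaf_flip p = (case SOME b. b \<in> leaf_flip_pieces \<and> p \<in> form_region (fst b) of (B, u, v) \<Rightarrow> form_pair u v p)"

lemma vector_2_eq_iff: "(vector [a, b] :: real^2) = vector [c, d] \<longleftrightarrow> a = c \<and> b = d"
  by (auto simp: vec_eq_iff forall_2)

lemma vec2_eq_iff: "(p :: real^2) = q \<longleftrightarrow> p $ 1 = q $ 1 \<and> p $ 2 = q $ 2"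
  by (auto simp: vec_eq_iff forall_2)

interpretation coord_swap: unimodular_involution "{({}, (0, 1, 0), (1, 0, 0))}" coord_swap
  by unfold_locales
    (auto simp: coord_swap_def form_pair_def form_region_def mem_unit_square vec2_eq_iff)

interpretation mirror: unimodular_involution "{({}, (-1, 0, 1), (0, 1, 0))}" mirror
  by unfold_locales
    (auto simp: mirror_def form_pair_def form_region_def mem_unit_square vec2_eq_iff)

text \<open>A check of all pairs of pieces. Nonnegative coordinates matter: they shrink, for
  example, the overlap of \<open>z \<le> 0\<close> with \<open>y \<le> z\<close> to the corner
  \<open>(1, 0)\<close>.\<close>

lemma leaf_flip_pieces_agree:
  assumes "(B, u, v) \<in> leaf_flip_pieces" "p \<in> form_region B"
    and "(B', u', v') \<in> leaf_flip_pieces" "p \<in> form_region B'" and "p \<in> unit_square"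
  shows "form_pair u v p = form_pair u' v' p"
proof -
  have "0 \<le> p $ 1" "0 \<le> p $ 2" using assms(5) by (auto simp: mem_unit_square)
  with assms(1-4) show ?thesis
    unfolding leaf_flip_pieces_def
    by (elim insertE emptyE;
        clarsimp simp: form_pair_def form_region_def vector_2_eq_iff; (intro conjI)?; linarith)
qed

lemma leaf_flip_piece:
  assumes "(B, u, v) \<in> leaf_flip_pieces" "p \<in> form_region B" "p \<in> unit_square"
  shows "leaf_flip p = form_pair u v p"
proof -
  define b where "b = (SOME b. b \<in> leaf_flip_pieces \<and> p \<in> form_region (fst b))"
  have "b \<in> leaf_flip_pieces \<and> p \<in> form_region (fst b)"
    unfolding b_def by (rule someI[of _ "(B, u, v)"]) (use assms in simp)
  then show ?thesis
    unfolding leaf_flip_def b_def[symmetric]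
    using leaf_flip_pieces_agree[OF assms(1,2) _ _ assms(3)] by (cases b) auto
qed

text \<open>Items 3, 7, 6 are the first stretch, of length \<open>t\<close>, of the bottom edge, the
  hypotenuse and the left edge, in the direction of increasing arc length; items 4, 8, 5 are the
  remainders of these edges, where the bound 1/4 on the level is automatic.\<close>

lemma leaf_flip_values:
  fixes p :: "real^2" and x y z :: real
  assumes p: "p \<in> unit_square" and xyz: "p $ 1 = x" "p $ 2 = y" "z = 1 - x - y"
  shows "z \<le> 0 \<Longrightarrow> leaf_flip p = vector [y, x]"
    and "1/4 \<le> x \<Longrightarrow> 1/4 \<le> y \<Longrightarrow> 1/4 \<le> z \<Longrightarrow> leaf_flip p = vector [z, y]"
    and "y \<le> x \<Longrightarrow> y \<le> z \<Longrightarrow> x \<le> 2 * y \<Longrightarrow> y \<le> 1/4 \<Longrightarrow> leaf_flip p = vector [3 * y - x, y]"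
    and "y \<le> z \<Longrightarrow> 2 * y \<le> x \<Longrightarrow> leaf_flip p = vector [y, x - y]"
    and "x \<le> y \<Longrightarrow> 2 * x \<le> z \<Longrightarrow> leaf_flip p = vector [x + y, x]"
    and "x \<le> y \<Longrightarrow> x \<le> z \<Longrightarrow> z \<le> 2 * x \<Longrightarrow> x \<le> 1/4 \<Longrightarrow> leaf_flip p = vector [2 - 5 * x - y, 4 * x + y - 1]"
    and "z \<le> x \<Longrightarrow> z \<le> y \<Longrightarrow> y \<le> 2 * z \<Longrightarrow> z \<le> 1/4 \<Longrightarrow> leaf_flip p = vector [z, 4 * x + 5 * y - 3]"
    and "z \<le> x \<Longrightarrow> 2 * z \<le> y \<Longrightarrow> 0 \<le> z \<Longrightarrow> leaf_flip p = vector [x + 2 * y - 1, 1 - y]"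
proof -
  show "leaf_flip p = vector [y, x]" if "z \<le> 0"
    using that xyz leaf_flip_piece[OF _ _ p, of "{(1, 1, -1)}" "(0, 1, 0)" "(1, 0, 0)"]
    by (simp add: leaf_flip_pieces_def form_region_def form_pair_def vector_2_eq_iff)
  show "leaf_flip p = vector [z, y]" if "1/4 \<le> x" "1/4 \<le> y" "1/4 \<le> z"
    using that xyz leaf_flip_piece[OF _ _ p, of "{(4, 0, -1), (0, 4, -1), (-4, -4, 3)}" "(-1, -1, 1)" "(0, 1, 0)"]
    by (simp add: leaf_flip_pieces_def form_region_def form_pair_def vector_2_eq_iff)
  show "leaf_flip p = vector [3 * y - x, y]" if "y \<le> x" "y \<le> z" "x \<le> 2 * y" "y \<le> 1/4"
    using that xyz leaf_flip_piece[OF _ _ p, of "{(1, -1, 0), (-1, -2, 1), (-1, 2, 0), (0, -4, 1)}" "(-1, 3, 0)" "(0, 1, 0)"]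
    by (simp add: leaf_flip_pieces_def form_region_def form_pair_def vector_2_eq_iff)
  show "leaf_flip p = vector [y, x - y]" if "y \<le> z" "2 * y \<le> x"
    using that xyz leaf_flip_piece[OF _ _ p, of "{(-1, -2, 1), (1, -2, 0)}" "(0, 1, 0)" "(1, -1, 0)"]
    by (simp add: leaf_flip_pieces_def form_region_def form_pair_def vector_2_eq_iff)
  show "leaf_flip p = vector [x + y, x]" if "x \<le> y" "2 * x \<le> z"
    using that xyz leaf_flip_piece[OF _ _ p, of "{(-1, 1, 0), (-3, -1, 1)}" "(1, 1, 0)" "(1, 0, 0)"]
    by (simp add: leaf_flip_pieces_def form_region_def form_pair_def vector_2_eq_iff)
  show "leaf_flip p = vector [2 - 5 * x - y, 4 * x + y - 1]" if "x \<le> y" "x \<le> z" "z \<le> 2 * x" "x \<le> 1/4"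
    using that xyz leaf_flip_piece[OF _ _ p, of "{(-1, 1, 0), (-2, -1, 1), (3, 1, -1), (-4, 0, 1)}" "(-5, -1, 2)" "(4, 1, -1)"]
    by (simp add: leaf_flip_pieces_def form_region_def form_pair_def vector_2_eq_iff)
  show "leaf_flip p = vector [z, 4 * x + 5 * y - 3]" if "z \<le> x" "z \<le> y" "y \<le> 2 * z" "z \<le> 1/4"
    using that xyz leaf_flip_piece[OF _ _ p, of "{(2, 1, -1), (1, 2, -1), (-2, -3, 2), (4, 4, -3)}" "(-1, -1, 1)" "(4, 5, -3)"]
    by (simp add: leaf_flip_pieces_def form_region_def form_pair_def vector_2_eq_iff)
  show "leaf_flip p = vector [x + 2 * y - 1, 1 - y]" if "z \<le> x" "2 * z \<le> y" "0 \<le> z"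
    using that xyz leaf_flip_piece[OF _ _ p, of "{(2, 1, -1), (2, 3, -2), (-1, -1, 1)}" "(1, 2, -1)" "(0, -1, 1)"]
    by (simp add: leaf_flip_pieces_def form_region_def form_pair_def vector_2_eq_iff)
qed

lemma unit_square_cases:
  assumes "p \<in> unit_square" and "p $ 1 = x" "p $ 2 = y" "z = 1 - x - y"
  obtains "z \<le> 0"
    | "1/4 \<le> x" "1/4 \<le> y" "1/4 \<le> z"
    | "y \<le> x" "y \<le> z" "x \<le> 2 * y" "y \<le> 1/4"
    | "y \<le> z" "2 * y \<le> x"
    | "x \<le> y" "2 * x \<le> z"
    | "x \<le> y" "x \<le> z" "z \<le> 2 * x" "x \<le> 1/4"
    | "z \<le> x" "z \<le> y" "y \<le> 2 * z" "z \<le> 1/4"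
    | "z \<le> x" "2 * z \<le> y" "0 \<le> z"
proof -
  have "0 \<le> x" "0 \<le> y" using assms by (auto simp: mem_unit_square)
  consider "z \<le> 0" | "1/4 \<le> x" "1/4 \<le> y" "1/4 \<le> z"
    | "0 \<le> z" "y \<le> x" "y \<le> z" "y \<le> 1/4" | "0 \<le> z" "x \<le> y" "x \<le> z" "x \<le> 1/4"
    | "0 \<le> z" "z \<le> x" "z \<le> y" "z \<le> 1/4"
    by argo
  then show ?thesis
  proof cases
    case 3
    then show ?thesis using that(3,4) by (cases "x \<le> 2 * y") auto
  next
    case 4
    then show ?thesis using that(5,6) by (cases "2 * x \<le> z") auto
  next
    case 5
    then show ?thesis using that(7,8) by (cases "y \<le> 2 * z") auto
  qed (use that(1,2) in auto)
qed

text \<open>The reflection maps pieces 1, 2, 3 and 8 to themselves and exchanges 4 with 5 and 6 with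
  7; this decides which formula applies to the image in each case.\<close>

interpretation leaf_flip: unimodular_involution leaf_flip_pieces leaf_flip
proof
  fix p assume p: "p \<in> unit_square"
  have xy: "0 \<le> p $ 1" "p $ 1 \<le> 1" "0 \<le> p $ 2" "p $ 2 \<le> 1" using p by (auto simp: mem_unit_square)
  have "\<exists>b \<in> leaf_flip_pieces. p \<in> form_region (fst b)"
    using p by (rule unit_square_cases[OF _ refl refl refl])
      (simp_all add: leaf_flip_pieces_def form_region_def)
  then show "\<exists>(B, u, v) \<in> leaf_flip_pieces. p \<in> form_region B" by force
  have "leaf_flip p \<in> unit_square \<and> leaf_flip (leaf_flip p) = p"
    using p
  proof (rule unit_square_cases[OF _ refl refl refl])
    assume h: "(1 - p $ 1 - p $ 2) \<le> 0"
    have v: "leaf_flip p = vector [p $ 2, p $ 1]" using leaf_flip_values(1)[OF p refl refl refl] h by simp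
    have q: "leaf_flip p \<in> unit_square" using h xy by (simp add: v mem_unit_square)
    show ?thesis
      using leaf_flip_values(1)[OF q refl refl refl] q h xy by (simp add: v vec2_eq_iff)
  next
    assume h: "1/4 \<le> p $ 1" "1/4 \<le> p $ 2" "1/4 \<le> (1 - p $ 1 - p $ 2)"
    have v: "leaf_flip p = vector [(1 - p $ 1 - p $ 2), p $ 2]" using leaf_flip_values(2)[OF p refl refl refl] h by simp
    have q: "leaf_flip p \<in> unit_square" using h xy by (simp add: v mem_unit_square)
    show ?thesis
      using leaf_flip_values(2)[OF q refl refl refl] q h xy by (simp add: v vec2_eq_iff)
  next
    assume h: "p $ 2 \<le> p $ 1" "p $ 2 \<le> (1 - p $ 1 - p $ 2)" "p $ 1 \<le> 2 * p $ 2" "p $ 2 \<le> 1/4"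
    have v: "leaf_flip p = vector [3 * p $ 2 - p $ 1, p $ 2]" using leaf_flip_values(3)[OF p refl refl refl] h by simp
    have q: "leaf_flip p \<in> unit_square" using h xy by (simp add: v mem_unit_square)
    show ?thesis
      using leaf_flip_values(3)[OF q refl refl refl] q h xy by (simp add: v vec2_eq_iff)
  next
    assume h: "p $ 2 \<le> (1 - p $ 1 - p $ 2)" "2 * p $ 2 \<le> p $ 1"
    have v: "leaf_flip p = vector [p $ 2, p $ 1 - p $ 2]" using leaf_flip_values(4)[OF p refl refl refl] h by simp
    have q: "leaf_flip p \<in> unit_square" using h xy by (simp add: v mem_unit_square)
    show ?thesis
      using leaf_flip_values(5)[OF q refl refl refl] q h xy by (simp add: v vec2_eq_iff)
  next
    assume h: "p $ 1 \<le> p $ 2" "2 * p $ 1 \<le> (1 - p $ 1 - p $ 2)"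
    have v: "leaf_flip p = vector [p $ 1 + p $ 2, p $ 1]" using leaf_flip_values(5)[OF p refl refl refl] h by simp
    have q: "leaf_flip p \<in> unit_square" using h xy by (simp add: v mem_unit_square)
    show ?thesis
      using leaf_flip_values(4)[OF q refl refl refl] q h xy by (simp add: v vec2_eq_iff)
  next
    assume h: "p $ 1 \<le> p $ 2" "p $ 1 \<le> (1 - p $ 1 - p $ 2)" "(1 - p $ 1 - p $ 2) \<le> 2 * p $ 1" "p $ 1 \<le> 1/4"
    have v: "leaf_flip p = vector [2 - 5 * p $ 1 - p $ 2, 4 * p $ 1 + p $ 2 - 1]" using leaf_flip_values(6)[OF p refl refl refl] h by simp
    have q: "leaf_flip p \<in> unit_square" using h xy by (simp add: v mem_unit_square)
    show ?thesis
      using leaf_flip_values(7)[OF q refl refl refl] q h xy by (simp add: v vec2_eq_iff)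
  next
    assume h: "(1 - p $ 1 - p $ 2) \<le> p $ 1" "(1 - p $ 1 - p $ 2) \<le> p $ 2" "p $ 2 \<le> 2 * (1 - p $ 1 - p $ 2)" "(1 - p $ 1 - p $ 2) \<le> 1/4"
    have v: "leaf_flip p = vector [(1 - p $ 1 - p $ 2), 4 * p $ 1 + 5 * p $ 2 - 3]" using leaf_flip_values(7)[OF p refl refl refl] h by simp
    have q: "leaf_flip p \<in> unit_square" using h xy by (simp add: v mem_unit_square)
    show ?thesis
      using leaf_flip_values(6)[OF q refl refl refl] q h xy by (simp add: v vec2_eq_iff)
  next
    assume h: "(1 - p $ 1 - p $ 2) \<le> p $ 1" "2 * (1 - p $ 1 - p $ 2) \<le> p $ 2" "0 \<le> (1 - p $ 1 - p $ 2)"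
    have v: "leaf_flip p = vector [p $ 1 + 2 * p $ 2 - 1, 1 - p $ 2]" using leaf_flip_values(8)[OF p refl refl refl] h by simp
    have q: "leaf_flip p \<in> unit_square" using h xy by (simp add: v mem_unit_square)
    show ?thesis
      using leaf_flip_values(8)[OF q refl refl refl] q h xy by (simp add: v vec2_eq_iff)
  qed
  then show "leaf_flip p \<in> unit_square" "leaf_flip (leaf_flip p) = p" by auto
next
  show "finite leaf_flip_pieces" by (simp add: leaf_flip_pieces_def)
  fix B u v assume B: "(B, u, v) \<in> leaf_flip_pieces"
  then show "finite B" unfolding leaf_flip_pieces_def by (elim insertE emptyE) simp_all
  show "form_det u v = -1" using B unfolding leaf_flip_pieces_def by (elim insertE emptyE) simp_all
  fix p assume "p \<in> form_region B" "p \<in> unit_square"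
  then show "leaf_flip p = form_pair u v p" by (rule leaf_flip_piece[OF B])
qed

section \<open>Leaves and their arc length parametrisation\<close>

definition level :: "real^2 \<Rightarrow> real" where
  "level p = min (p $ 1) (min (p $ 2) (1 - p $ 1 - p $ 2))"

definition wrap :: "real \<Rightarrow> real \<Rightarrow> real" where
  "wrap l s = s - l * of_int \<lfloor>s / l\<rfloor>"

lemma wrap_add: "l > 0 \<Longrightarrow> wrap l (s + l * of_int k) = wrap l s"
  by (simp add: wrap_def add_divide_distrib distrib_left)

lemma wrap_bounds:
  assumes "l > 0"
  shows "0 \<le> wrap l s" "wrap l s < l"
proof -
  have s: "l * (s / l) = s" using assms by simp
  have "l * of_int \<lfloor>s / l\<rfloor> \<le> l * (s / l)" using assms by (intro mult_left_mono) auto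
  then show "0 \<le> wrap l s" unfolding s wrap_def by linarith
  have "l * (s / l) < l * (of_int \<lfloor>s / l\<rfloor> + 1)" using assms by (intro mult_strict_left_mono) linarith+
  then show "wrap l s < l" unfolding s wrap_def distrib_left by linarith
qed

lemma wrap_id:
  assumes "0 \<le> s" "s < l"
  shows "wrap l s = s"
proof -
  have "\<lfloor>s / l\<rfloor> = 0" using assms by (intro floor_unique) auto
  then show ?thesis by (simp add: wrap_def)
qed

text \<open>Arc length parametrisation of the leaf of level \<open>t\<close>, starting at \<open>(t, t)\<close> along the horizontal edge.\<close>

definition leaf :: "real \<Rightarrow> real \<Rightarrow> real^2" where
  "leaf t s = (let l = 1 - 3 * t; u = wrap (3 * l) s in
     if u \<le> l then vector [t + u, t]
     else if u \<le> 2 * l then vector [t + 2 * l - u, t + u - l]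
     else vector [t, t + 3 * l - u])"

lemma leaf_add_period:
  assumes "t < 1/4"
  shows "leaf t (s + 3 * (1 - 3 * t) * of_int k) = leaf t s"
proof -
  have "3 * (1 - 3 * t) > 0" using assms by simp
  then show ?thesis by (simp only: leaf_def Let_def wrap_add)
qed

lemma period_reduce:
  assumes "t < (1/4::real)"
  obtains u k where "s = u + 3 * (1 - 3 * t) * of_int k" "0 \<le> u" "u < 3 * (1 - 3 * t)"
proof -
  have "s = wrap (3 * (1 - 3 * t)) s + 3 * (1 - 3 * t) * of_int \<lfloor>s / (3 * (1 - 3 * t))\<rfloor>"
    by (simp only: wrap_def)
  then show ?thesis using that wrap_bounds[of "3 * (1 - 3 * t)" s] assms by simp
qed

text \<open>The right end point is allowed because the left edge returns to \<open>(t, t)\<close>,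
  the point of parameter 0; case distinctions can then use closed intervals.\<close>

lemma leaf_base:
  assumes "t < 1/4" "0 \<le> u" "u \<le> 3 * (1 - 3 * t)"
  shows "leaf t u = (let l = 1 - 3 * t in
     if u \<le> l then vector [t + u, t]
     else if u \<le> 2 * l then vector [t + 2 * l - u, t + u - l]
     else vector [t, t + 3 * l - u])"
proof (cases "u = 3 * (1 - 3 * t)")
  case True
  have "leaf t u = leaf t 0" using leaf_add_period[OF assms(1), of 0 1] True by simp
  also have "\<dots> = vector [t, t]" using assms(1) wrap_id[of 0 "3 * (1 - 3 * t)"] by (simp add: leaf_def Let_def)
  finally show ?thesis using assms(1) True by (simp add: Let_def)
next
  case False
  then have "wrap (3 * (1 - 3 * t)) u = u" using assms by (intro wrap_id) auto
  then show ?thesis by (simp only: leaf_def Let_def)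
qed

lemma level_leaf:
  assumes "t < 1/4"
  shows "level (leaf t s) = t"
proof -
  obtain u k where u: "s = u + 3 * (1 - 3 * t) * of_int k" "0 \<le> u" "u < 3 * (1 - 3 * t)"
    using period_reduce[OF assms] .
  show ?thesis unfolding u(1) leaf_add_period[OF assms]
    using leaf_base[OF assms, of u] u assms by (auto simp: level_def Let_def min_def)
qed

lemma leaf_in_square:
  assumes "0 \<le> t" "t < 1/4"
  shows "leaf t s \<in> unit_square"
proof -
  obtain u k where u: "s = u + 3 * (1 - 3 * t) * of_int k" "0 \<le> u" "u < 3 * (1 - 3 * t)"
    using period_reduce[OF assms(2)] .
  show ?thesis unfolding u(1) leaf_add_period[OF assms(2)]
    using u assms by (auto simp: leaf_base mem_unit_square Let_def)
qed

text \<open>The swap fixes the starting corner \<open>(t, t)\<close> and reverses the orientation of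
  the leaf.\<close>

lemma coord_swap_leaf:
  assumes t: "t < 1/4"
  shows "coord_swap (leaf t s) = leaf t (- s)"
proof -
  obtain u k where u: "s = u + 3 * (1 - 3 * t) * of_int k" "0 \<le> u" "u < 3 * (1 - 3 * t)"
    using period_reduce[OF t] .
  have "- s = (3 * (1 - 3 * t) - u) + 3 * (1 - 3 * t) * of_int (- 1 - k)"
    by (simp add: u(1) algebra_simps)
  then have "leaf t (- s) = leaf t (3 * (1 - 3 * t) - u)" by (metis leaf_add_period[OF t])
  moreover have "leaf t s = leaf t u" unfolding u(1) by (rule leaf_add_period[OF t])
  moreover have "coord_swap (leaf t u) = leaf t (3 * (1 - 3 * t) - u)"
    using u t by (auto simp: leaf_base coord_swap_def Let_def vector_2_eq_iff)
  ultimately show ?thesis by simp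
qed

text \<open>The last six pieces divide the leaf into six stretches. Each is carried to a single
  stretch by one affine formula, so the claim is linear arithmetic in every case.\<close>

lemma leaf_flip_leaf:
  assumes t: "0 < t" "t < 1/4"
  shows "leaf_flip (leaf t s) = leaf t (t - s)"
proof -
  obtain u k where u: "s = u + 3 * (1 - 3 * t) * of_int k" "0 \<le> u" "u < 3 * (1 - 3 * t)"
    using period_reduce[OF t(2)] .
  \<comment> \<open>\<open>t - s\<close> reduced to one period: a full turn is added once
    \<open>u\<close> exceeds \<open>t\<close>.\<close>
  define w where "w = (if u \<le> t then t - u else 3 * (1 - 3 * t) + t - u)"
  have "t - s = w + 3 * (1 - 3 * t) * of_int ((if u \<le> t then 0 else - 1) - k)"
    by (simp add: u(1) w_def algebra_simps)
  then have "leaf t (t - s) = leaf t w" by (metis leaf_add_period[OF t(2)])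
  moreover have "leaf t s = leaf t u" unfolding u(1) by (rule leaf_add_period[OF t(2)])
  moreover have "leaf_flip (leaf t u) = leaf t w"
  proof -
    define l where "l = 1 - 3 * t"
    \<comment> \<open>Equivalent to \<open>t < 1/4\<close>: an edge is longer than the rotation, so
      it splits into a stretch of length \<open>t\<close> and a remainder.\<close>
    have t_l: "t < l" using t by (simp add: l_def)
    have w: "0 \<le> w" "w \<le> 3 * l" using u t by (auto simp: w_def l_def)
    note base = leaf_base[OF t(2), folded l_def, unfolded Let_def]
    note flip = leaf_flip_values[OF leaf_in_square[OF less_imp_le[OF t(1)] t(2), of u] refl refl refl]
    consider "u \<le> t" | "t < u" "u \<le> l" | "l < u" "u \<le> l + t" | "l + t < u" "u \<le> 2 * l"
      | "2 * l < u" "u \<le> 2 * l + t" | "2 * l + t < u" by linarith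
    then show ?thesis
    proof cases
      case 1
      then have w_eq: "w = t - u" using t by (simp add: w_def l_def)
      have lu: "leaf t u = vector [t + u, t]" using 1 u t t_l by (simp add: base l_def)
      have "leaf t w = vector [t + w, t]" using 1 t u t_l w by (auto simp: base w_eq vector_2_eq_iff)
      then show ?thesis using flip(3) 1 t t_l u by (simp add: lu w_eq l_def vector_2_eq_iff)
    next
      case 2
      then have w_eq: "w = 3 * l + t - u" using t by (simp add: w_def l_def)
      have lu: "leaf t u = vector [t + u, t]" using 2 u t t_l by (simp add: base l_def)
      have "leaf t w = vector [t, t + 3 * l - w]" using 2 t u t_l w by (auto simp: base w_eq vector_2_eq_iff)
      then show ?thesis using flip(4) 2 t t_l u by (simp add: lu w_eq l_def vector_2_eq_iff)
    next
      case 3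
      then have w_eq: "w = 3 * l + t - u" using t by (simp add: w_def l_def)
      have lu: "leaf t u = vector [t + 2 * l - u, t + u - l]" using 3 u t t_l by (simp add: base l_def)
      have "leaf t w = vector [t, t + 3 * l - w]" using 3 t u t_l w by (auto simp: base w_eq vector_2_eq_iff)
      then show ?thesis using flip(7) 3 t t_l u by (simp add: lu w_eq l_def vector_2_eq_iff)
    next
      case 4
      then have w_eq: "w = 3 * l + t - u" using t by (simp add: w_def l_def)
      have lu: "leaf t u = vector [t + 2 * l - u, t + u - l]" using 4 u t t_l by (simp add: base l_def)
      have "leaf t w = vector [t + 2 * l - w, t + w - l]" using 4 t u t_l w by (auto simp: base w_eq vector_2_eq_iff)
      then show ?thesis using flip(8) 4 t t_l u by (simp add: lu w_eq l_def vector_2_eq_iff)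
    next
      case 5
      then have w_eq: "w = 3 * l + t - u" using t by (simp add: w_def l_def)
      have lu: "leaf t u = vector [t, t + 3 * l - u]" using 5 u t t_l by (simp add: base l_def)
      have "leaf t w = vector [t + 2 * l - w, t + w - l]" using 5 t u t_l w by (auto simp: base w_eq vector_2_eq_iff)
      then show ?thesis using flip(6) 5 t t_l u by (simp add: lu w_eq l_def vector_2_eq_iff)
    next
      case 6
      then have w_eq: "w = 3 * l + t - u" using t by (simp add: w_def l_def)
      have lu: "leaf t u = vector [t, t + 3 * l - u]" using 6 u t t_l by (simp add: base l_def)
      have "leaf t w = vector [t + w, t]" using 6 t u t_l w by (auto simp: base w_eq vector_2_eq_iff)
      then show ?thesis using flip(5) 6 t t_l u by (simp add: lu w_eq l_def vector_2_eq_iff)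
    qed
  qed
  ultimately show ?thesis by simp
qed

lemma leaf_bottom:
  assumes "t < 1/4" "0 \<le> u" "u \<le> 1 - 3 * t"
  shows "leaf t u = vector [t + u, t]"
  using assms by (simp add: leaf_base)

lemma leaf_hypotenuse:
  assumes "t < 1/4" "0 \<le> e" "e \<le> 1 - 3 * t"
  shows "leaf t (1 - 3 * t + e) = vector [1 - 2 * t - e, t + e]"
  using assms by (auto simp: leaf_base Let_def vector_2_eq_iff)

lemma on_leaf:
  assumes "level p < 1/4"
  obtains s where "p = leaf (level p) s"
proof -
  define t where "t = level p"
  have t: "t < 1/4" "t \<le> p $ 1" "t \<le> p $ 2" "t \<le> 1 - p $ 1 - p $ 2" using assms by (auto simp: t_def level_def)
  have "t = p $ 1 \<or> t = p $ 2 \<or> t = 1 - p $ 1 - p $ 2" by (simp add: t_def level_def min_def)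
  then consider "t = p $ 1" | "t = p $ 2" | "t = 1 - p $ 1 - p $ 2" by blast
  then show ?thesis
  proof cases
    case 1
    then have "leaf t (3 * (1 - 3 * t) + t - p $ 2) = p" using t
      by (auto simp: leaf_base Let_def vec2_eq_iff)
    then show ?thesis using that unfolding t_def by metis
  next
    case 2
    then have "leaf t (p $ 1 - t) = p" using t by (auto simp: leaf_bottom vec2_eq_iff)
    then show ?thesis using that unfolding t_def by metis
  next
    case 3
    then have "leaf t (1 - 3 * t + (p $ 2 - t)) = p" using t by (subst leaf_hypotenuse) (auto simp: vec2_eq_iff)
    then show ?thesis using that unfolding t_def by metis
  qed
qed

definition twist :: "real^2 \<Rightarrow> real^2" where
  "twist p = leaf_flip (coord_swap p)"

text \<open>The reflections \<open>s -> - s\<close> and \<open>s -> t - s\<close> of the leaf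
  compose to the translation by \<open>t\<close>.\<close>

lemma twist_power_leaf:
  assumes "0 < t" "t < 1/4"
  shows "(twist ^^ n) (leaf t s) = leaf t (s + real n * t)"
proof (induction n)
  case (Suc n)
  then show ?case using assms
    by (simp add: twist_def coord_swap_leaf leaf_flip_leaf algebra_simps)
qed simp

text \<open>The ratio of rotation to perimeter is an invertible fractional linear expression in
  \<open>t\<close> with rational coefficients, hence irrational. Kronecker's density theorem
  applies, with positive multiples, so forward powers of the twist suffice.\<close>

lemma irrational_leaf_dense:
  assumes t: "t \<notin> \<rat>" "0 < t" "t < 1/4" and e: "e > (0::real)"
  obtains n :: nat and m :: int where "\<bar>real n * t - 3 * (1 - 3 * t) * of_int m - r\<bar> < e"
proof -
  define l where "l = 3 * (1 - 3 * t)"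
  have l: "l > 0" using t by (simp add: l_def)
  have "t / l \<notin> \<rat>"
  proof
    assume q: "t / l \<in> \<rat>"
    define q where "q = t / l"
    have "t = q * (3 - 9 * t)" using l by (simp add: q_def l_def)
    then have eq: "t * (1 + 9 * q) = 3 * q" by (simp add: algebra_simps)
    have "q > 0" using t l by (simp add: q_def)
    then have "t = 3 * q / (1 + 9 * q)" using eq by (simp add: field_simps)
    moreover have "3 * q / (1 + 9 * q) \<in> \<rat>" using q by (auto simp: q_def[symmetric])
    ultimately show False using t(1) by simp
  qed
  moreover have "e / l > 0" using e l by simp
  ultimately obtain h k where k: "k > 0" "\<bar>of_int k * (t / l) - of_int h - r / l\<bar> < e / l"
    using sequence_of_fractional_parts_is_dense[of "t / l" "e / l" "r / l"] by metis
  have "real_of_int k * t - l * of_int h - r = l * (of_int k * (t / l) - of_int h - r / l)"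
    using l by (simp add: field_simps)
  then have "\<bar>real_of_int k * t - l * of_int h - r\<bar> = l * \<bar>of_int k * (t / l) - of_int h - r / l\<bar>"
    using l by (simp add: abs_mult)
  also have "\<dots> < l * (e / l)" using k(2) l by (rule mult_strict_left_mono)
  finally have "\<bar>real (nat k) * t - l * of_int h - r\<bar> < e" using k(1) l by simp
  then show ?thesis using that by (simp add: l_def)
qed

subsection \<open>Invariant measures\<close>

lemma mcnaughton_function_regions:
  assumes fin: "finite ps" "\<And>B u. (B, u) \<in> ps \<Longrightarrow> finite B"
    and cover: "\<And>p. p \<in> unit_square \<Longrightarrow> \<exists>(B, u) \<in> ps. p \<in> form_region B"
    and piece: "\<And>B u p. (B, u) \<in> ps \<Longrightarrow> p \<in> form_region B \<Longrightarrow> p \<in> unit_square \<Longrightarrow> f p = form_at u p"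
    and cont: "continuous_on unit_square f" and range: "f \<in> unit_square \<rightarrow> {0..1}"
  shows "mcnaughton_function f"
proof -
  obtain K where K: "rational_square_complex K"
    "\<And>C. C \<in> K \<Longrightarrow> aff_dim C = 2 \<Longrightarrow> \<exists>B\<in>fst ` ps. C \<subseteq> form_region B"
  proof (rule complex_refining_regions[of "fst ` ps"])
    show "unit_square \<subseteq> (\<Union>B\<in>fst ` ps. form_region B)" using cover by force
  qed (use fin in auto)
  have "\<exists>a1 a2 a3 :: int. \<forall>x\<in>C. f x = of_int a1 * x $ 1 + of_int a2 * x $ 2 + of_int a3"
    if C: "C \<in> K" "aff_dim C = 2" for C
  proof -
    obtain B a b c where B: "(B, a, b, c) \<in> ps" "C \<subseteq> form_region B" using K(2)[OF C] by auto
    have "C \<subseteq> unit_square" using K(1) C(1) by (auto simp: rational_square_complex_def)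
    then have "f x = form_at (a, b, c) x" if "x \<in> C" for x using piece[OF B(1)] B(2) that by blast
    then show ?thesis by (metis form_at.simps)
  qed
  then show ?thesis using K(1) cont range unfolding mcnaughton_function_def by blast
qed

lemma mcnaughton_function_one: "mcnaughton_function (\<lambda>_. 1)"
  by (rule mcnaughton_function_regions[of "{({}, (0, 0, 1))}"]) (auto simp: form_region_def)

text \<open>It has the same zeros as the form, which makes it the test function for rational lines.
  The four pieces are \<open>0 \<le> h \<le> 1\<close>, \<open>-1 \<le> h \<le> 0\<close>,
  \<open>1 \<le> h\<close> and \<open>h \<le> -1\<close>.\<close>

lemma mcnaughton_function_abs_form: "mcnaughton_function (\<lambda>p. min 1 \<bar>form_at h p\<bar>)"
proof -
  obtain a b c where h: "h = (a, b, c)" by (cases h)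
  show ?thesis
  proof (rule mcnaughton_function_regions[of "{({(a, b, c), (-a, -b, 1 - c)}, (a, b, c)), ({(-a, -b, -c), (a, b, 1 + c)}, (-a, -b, -c)),
        ({(a, b, c - 1)}, (0, 0, 1)), ({(-a, -b, - c - 1)}, (0, 0, 1))}"])
    show "continuous_on unit_square (\<lambda>p. min 1 \<bar>form_at h p\<bar>)"
      by (intro continuous_intros)
  qed (auto simp: form_region_def h)
qed

lemma mv_multiple_le_one: "mv_multiple k f x \<le> 1"
  by (cases k) (auto simp: mv_plus_def)

lemma mv_multiple_zero: "f x = 0 \<Longrightarrow> mv_multiple k f x = 0"
  by (induction k) (auto simp: mv_plus_def)

lemma mv_multiple_one: "k \<ge> 1 \<Longrightarrow> mv_multiple k (\<lambda>_. 1) x = 1"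
proof (induction k)
  case (Suc k)
  then show ?case by (cases k) (auto simp: mv_plus_def)
qed simp

text \<open>The square is the closure of its interior, so a nonempty relatively open subset contains
  a nonempty open subset of the plane, which no line does.\<close>

lemma form_line_empty_interior:
  assumes "a \<noteq> 0 \<or> b \<noteq> 0"
  shows "top_of_set unit_square interior_of {p \<in> unit_square. form_at (a, b, c) p = 0} = {}"
proof (rule ccontr)
  assume "\<not> ?thesis"
  then obtain p U where U: "openin (top_of_set unit_square) U" "p \<in> U" "U \<subseteq> {p \<in> unit_square. form_at (a, b, c) p = 0}"
    by (auto simp: interior_of_def)
  then obtain V where V: "open V" "U = V \<inter> unit_square" by (auto simp: openin_open)
  have "interior (unit_square :: (real^2) set) \<noteq> {}"
    by (simp add: interior_cbox box_ne_empty inner_Basis_inf_left)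
      (auto simp: Basis_vec_def inner_axis)
  then have "closure (interior unit_square) = (unit_square :: (real^2) set)"
    by (metis closure_cbox convex_box(1) convex_closure_interior)
  then have "p \<in> closure (interior unit_square)" using U(2) V(2) by blast
  then obtain q where q: "q \<in> interior unit_square" "q \<in> V"
    using V U(2) by (metis IntD1 closure_iff_nhds_not_empty disjoint_iff order_refl)
  then have "q \<in> interior (V \<inter> unit_square)" using V(1) by (simp add: interior_open)
  then have "q \<in> interior {p. (vector [of_int a, of_int b] :: real^2) \<bullet> p = - of_int c}"
    by (rule interior_mono[THEN subsetD, rotated])
      (use U(3) V(2) in \<open>auto simp: inner_vec_def sum_2\<close>)
  moreover have "(vector [of_int a, of_int b] :: real^2) \<noteq> 0" using assms by (auto simp: vec_eq_iff forall_2)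
  ultimately show False using interior_hyperplane by fast
qed

text \<open>All that the rest of the proof uses of a measure. Lebesgue measure qualifies as well, so
  the theorem becomes the uniqueness of such measures.\<close>

locale unimodular_measure =
  fixes M :: "(real^2) measure"
  assumes sets_M: "sets M = sets (restrict_space borel unit_square)"
    and total: "emeasure M unit_square = 1"
    and invariant: "unimodular_involution ps S \<Longrightarrow> A \<in> sets M \<Longrightarrow> emeasure M (S -` A \<inter> unit_square) = emeasure M A"
    and line_null: "a \<noteq> 0 \<or> b \<noteq> 0 \<Longrightarrow> emeasure M {p \<in> unit_square. form_at (a, b, c) p = 0} = 0"
begin

lemma sets_iff: "A \<in> sets M \<longleftrightarrow> A \<in> sets borel \<and> A \<subseteq> unit_square"
  unfolding sets_M by (auto simp: sets_restrict_space_iff)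

lemma space_M: "space M = unit_square"
  using sets_eq_imp_space_eq[OF sets_M] by (simp add: space_restrict_space)

lemma finite_measure: "emeasure M A < top"
proof -
  have "emeasure M A \<le> emeasure M (space M)" by (rule emeasure_space)
  then show ?thesis by (simp add: space_M total le_less_trans)
qed

end

lemma form_line_closed: "closed {p \<in> unit_square. form_at h p = 0}"
proof -
  have "closed ({p. form_at h p = 0} \<inter> unit_square)"
    by (intro closed_Int closed_Collect_eq continuous_on_form_at continuous_on_const closed_cbox)
  then show ?thesis by (simp add: Collect_conj_eq Int_commute)
qed

text \<open>Detection is tested on two kinds of functions. The constant 1 has empty zero set and
  gives the total mass; \<open>min 1 \<bar>h\<bar>\<close> gives the null lines, because its
  multiples never exceed the indicator of the complement of the line.\<close>

lemma unimodular_measure_of_invariant: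
  assumes sets: "sets \<mu> = sets (restrict_space borel unit_square)"
    and detects: "detects_pseudotruths \<mu>" and invariant: "automorphism_invariant \<mu>"
  shows "unimodular_measure \<mu>"
proof
  have sets_iff: "A \<in> sets \<mu> \<longleftrightarrow> A \<in> sets borel \<and> A \<subseteq> unit_square" for A
    unfolding sets by (auto simp: sets_restrict_space_iff)
  have space: "space \<mu> = unit_square"
    using sets_eq_imp_space_eq[OF sets] by (simp add: space_restrict_space)
  have SUP: "(SUP k\<in>{1..}. \<integral>\<^sup>+ x. ennreal (mv_multiple k f x) \<partial>\<mu>) = 1"
    if "mcnaughton_function f" "top_of_set unit_square interior_of {p \<in> unit_square. f p = 0} = {}" for f
    using detects that by (auto simp: detects_pseudotruths_def)
  have "(SUP k\<in>{1..}. \<integral>\<^sup>+ x. ennreal (mv_multiple k (\<lambda>_. 1) x) \<partial>\<mu>) = 1"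
    by (rule SUP) (auto simp: mcnaughton_function_one interior_of_def)
  moreover have "(SUP k\<in>{1..}. \<integral>\<^sup>+ x. ennreal (mv_multiple k (\<lambda>_. 1) x) \<partial>\<mu>) = (SUP k\<in>{1::nat..}. emeasure \<mu> unit_square)"
    by (intro SUP_cong refl) (simp add: mv_multiple_one space)
  ultimately show total: "emeasure \<mu> unit_square = 1" by simp
  show "sets \<mu> = sets (restrict_space borel unit_square)" by (rule sets)
  show "emeasure \<mu> (S -` A \<inter> unit_square) = emeasure \<mu> A" if "unimodular_involution ps S" "A \<in> sets \<mu>" for ps S A
    using invariant unimodular_involution.mcnaughton[OF that(1)] that(2)
    unfolding automorphism_invariant_def sets_iff by metis
  fix a b c :: int assume ab: "a \<noteq> 0 \<or> b \<noteq> 0"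
  define l where "l = {p \<in> unit_square. form_at (a, b, c) p = 0}"
  define f where "f p = min 1 \<bar>form_at (a, b, c) p\<bar>" for p
  have "f = (\<lambda>p. min 1 \<bar>form_at (a, b, c) p\<bar>)" by (simp add: f_def fun_eq_iff)
  then have f: "mcnaughton_function f" using mcnaughton_function_abs_form[of "(a, b, c)"] by (simp only:)
  have l: "l \<in> sets \<mu>" unfolding sets_iff l_def using form_line_closed by (auto intro: borel_closed)
  have sq: "unit_square \<in> sets \<mu>" unfolding sets_iff by auto
  have "{p \<in> unit_square. f p = 0} = l" by (auto simp: f_def l_def min_def)
  then have "(SUP k\<in>{1..}. \<integral>\<^sup>+ x. ennreal (mv_multiple k f x) \<partial>\<mu>) = 1"
    using SUP[OF f] form_line_empty_interior[OF ab, of c] by (simp only: l_def)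
  moreover have "(\<integral>\<^sup>+ x. ennreal (mv_multiple k f x) \<partial>\<mu>) \<le> emeasure \<mu> (unit_square - l)" for k
  proof -
    have "(\<integral>\<^sup>+ x. ennreal (mv_multiple k f x) \<partial>\<mu>) \<le> (\<integral>\<^sup>+ x. indicator (unit_square - l) x \<partial>\<mu>)"
    proof (rule nn_integral_mono)
      fix x assume "x \<in> space \<mu>"
      then show "ennreal (mv_multiple k f x) \<le> indicator (unit_square - l) x"
        using mv_multiple_le_one[of k f x] mv_multiple_zero[of f x k]
        by (cases "x \<in> l") (auto simp: space l_def f_def indicator_def)
    qed
    then show ?thesis using sq l by simp
  qed
  ultimately have "1 \<le> emeasure \<mu> (unit_square - l)" by (metis (no_types, lifting) SUP_least)
  moreover have "emeasure \<mu> (unit_square - l) + emeasure \<mu> l = 1"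
  proof -
    have "(unit_square - l) \<union> l = unit_square" by (auto simp: l_def)
    then show ?thesis using plus_emeasure[of "unit_square - l" \<mu> l] sq l total by auto
  qed
  ultimately have "1 + emeasure \<mu> l \<le> 1 + 0"
    using add_right_mono[of 1 "emeasure \<mu> (unit_square - l)" "emeasure \<mu> l"] by simp
  then have "emeasure \<mu> l \<le> 0" unfolding ennreal_add_left_cancel_le by simp
  then show "emeasure \<mu> {p \<in> unit_square. form_at (a, b, c) p = 0} = 0"
    unfolding l_def[symmetric] by simp
qed

lemma unimodular_measure_lborel: "unimodular_measure (restrict_space lborel unit_square)"
proof
  have sq: "unit_square \<inter> space lborel \<in> sets (lborel :: (real^2) measure)" by simp
  have emeasure: "emeasure (restrict_space lborel unit_square) A = emeasure lborel A"
    if "A \<subseteq> unit_square" for A :: "(real^2) set"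
    using emeasure_restrict_space[OF sq that] .
  show sets: "sets (restrict_space lborel unit_square) = sets (restrict_space borel (unit_square :: (real^2) set))"
    by (simp add: sets_restrict_space)
  have "emeasure lborel (unit_square :: (real^2) set) = (\<Prod>b\<in>Basis. ((1 - 0) :: real^2) \<bullet> b)"
    by (rule emeasure_lborel_cbox) (auto simp: Basis_vec_def inner_axis)
  also have "(\<Prod>b\<in>Basis. ((1 - 0) :: real^2) \<bullet> b) = 1"
    by (intro prod.neutral) (auto simp: Basis_vec_def inner_axis)
  finally show "emeasure (restrict_space lborel unit_square) (unit_square :: (real^2) set) = 1"
    by (simp add: emeasure)
  show "emeasure (restrict_space lborel unit_square) (S -` A \<inter> unit_square) = emeasure (restrict_space lborel unit_square) A"
    if "unimodular_involution ps S" "A \<in> sets (restrict_space lborel unit_square)" for ps S A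
  proof -
    have "A \<in> sets borel" "A \<subseteq> unit_square" using that(2) by (auto simp: sets_restrict_space_iff)
    then show ?thesis using unimodular_involution.emeasure_lborel_preimage[OF that(1)] by (simp add: emeasure)
  qed
  fix a b c :: int assume ab: "a \<noteq> 0 \<or> b \<noteq> 0"
  have "(vector [of_int a, of_int b] :: real^2) \<noteq> 0" using ab by (auto simp: vec_eq_iff forall_2)
  then have "negligible {p. (vector [of_int a, of_int b] :: real^2) \<bullet> p = - of_int c}"
    by (intro negligible_hyperplane) auto
  then have "negligible {p \<in> unit_square. form_at (a, b, c) p = 0}"
    by (rule negligible_subset) (auto simp: inner_vec_def sum_2)
  then have "emeasure lebesgue {p \<in> unit_square. form_at (a, b, c) p = 0} = 0"
    by (simp add: negligible_iff_null_sets null_sets_def)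
  then have "emeasure lborel {p \<in> unit_square. form_at (a, b, c) p = 0} = 0"
    using form_line_closed[of "(a, b, c)", THEN borel_closed] by simp
  then show "emeasure (restrict_space lborel unit_square) {p \<in> unit_square. form_at (a, b, c) p = 0} = 0"
    by (subst emeasure) auto
qed

subsection \<open>Recurrence along the leaves\<close>

lemma borel_measurable_level [measurable]: "level \<in> borel_measurable borel"
  unfolding level_def[abs_def] by (intro borel_measurable_continuous_onI continuous_intros)

lemma twist_in_square: "p \<in> unit_square \<Longrightarrow> twist p \<in> unit_square"
  by (simp add: twist_def leaf_flip.into_square coord_swap.into_square)

lemma twist_power_in_square: "p \<in> unit_square \<Longrightarrow> (twist ^^ n) p \<in> unit_square"
  by (induction n) (auto simp: twist_in_square)

lemma level_twist_power:
  assumes "0 < level p" "level p < 1/4"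
  shows "level ((twist ^^ n) p) = level p"
  using on_leaf[OF assms(2)] twist_power_leaf[OF assms] level_leaf[OF assms(2)] by metis

definition rational_level_set :: "(real^2) set" where
  "rational_level_set = {p \<in> unit_square. level p \<in> \<rat>}"

text \<open>The level is always one of \<open>x\<close>, \<open>y\<close>, \<open>z\<close>, so a
  rational level puts the point on a rational line; clearing denominators makes the form
  integral.\<close>

lemma rational_level_set_lines:
  "rational_level_set \<subseteq> (\<Union>h \<in> {(a, b, c). a \<noteq> 0 \<or> b \<noteq> 0}. {p \<in> unit_square. form_at h p = 0})"
proof
  fix p assume "p \<in> rational_level_set"
  then have p: "p \<in> unit_square" "level p \<in> \<rat>" by (auto simp: rational_level_set_def)
  obtain m n :: int where q: "n > 0" "level p = of_int m / of_int n" using p(2) by (metis Rats_cases')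
  have "level p = p $ 1 \<or> level p = p $ 2 \<or> level p = 1 - p $ 1 - p $ 2" by (simp add: level_def min_def)
  then have "form_at (n, 0, - m) p = 0 \<or> form_at (0, n, - m) p = 0 \<or> form_at (- n, - n, n - m) p = 0"
    using q by (auto simp: field_simps)
  moreover have "n \<noteq> 0" using q by simp
  ultimately obtain a b c where "form_at (a, b, c) p = 0" "a \<noteq> 0 \<or> b \<noteq> 0"
    by (metis neg_equal_0_iff_equal)
  then show "p \<in> (\<Union>h \<in> {(a, b, c). a \<noteq> 0 \<or> b \<noteq> 0}. {p \<in> unit_square. form_at h p = 0})"
    using p(1) by (intro UN_I[of "(a, b, c)"]) auto
qed

lemma rational_level_set_borel: "rational_level_set \<in> sets borel"
proof -
  have eq: "rational_level_set = (\<Union>q\<in>\<rat>. level -` {q} \<inter> unit_square)" by (auto simp: rational_level_set_def)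
  have "level -` {q} \<inter> unit_square \<in> sets borel" for q
    using measurable_sets[OF borel_measurable_level, of "{q}"] by simp
  then show ?thesis unfolding eq by (intro sets.countable_UN''[OF countable_rat]) auto
qed

text \<open>For small parameters with \<open>b \<le> c\<close>, the leaves run in the direction of the hypotenuse
  in the first box and horizontally in the second, which is its mirror image.\<close>

definition hyp_box :: "real \<Rightarrow> real \<Rightarrow> real \<Rightarrow> real \<Rightarrow> (real^2) set" where
  "hyp_box a b c d = {p \<in> unit_square. a \<le> 1 - p $ 1 - p $ 2 \<and> 1 - p $ 1 - p $ 2 \<le> b \<and> c \<le> p $ 2 \<and> p $ 2 \<le> d}"

definition base_box :: "real \<Rightarrow> real \<Rightarrow> real \<Rightarrow> real \<Rightarrow> (real^2) set" where
  "base_box a b c d = {p \<in> unit_square. a \<le> p $ 1 - p $ 2 \<and> p $ 1 - p $ 2 \<le> b \<and> c \<le> p $ 2 \<and> p $ 2 \<le> d}"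

text \<open>Mirroring turns \<open>x - y\<close> into \<open>1 - x - y\<close>. Sliding a base box
  along horizontal leaves thus corresponds to changing the levels of a hypotenuse box.\<close>

lemma mirror_base_box: "mirror -` base_box a b c d \<inter> unit_square = hyp_box a b c d"
  by (auto simp: hyp_box_def base_box_def mirror_def mem_unit_square)

lemma closed_hyp_box: "closed (hyp_box a b c d)"
proof -
  have "hyp_box a b c d = unit_square \<inter> {p. a \<le> 1 - p $ 1 - p $ 2} \<inter> {p. 1 - p $ 1 - p $ 2 \<le> b} \<inter>
    {p. c \<le> p $ 2} \<inter> {p. p $ 2 \<le> d}"
    by (auto simp: hyp_box_def)
  then show ?thesis
    by (auto intro!: closed_Int closed_cbox closed_Collect_le continuous_intros)
qed

lemma closed_base_box: "closed (base_box a b c d)"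
proof -
  have "base_box a b c d = unit_square \<inter> {p. a \<le> p $ 1 - p $ 2} \<inter> {p. p $ 1 - p $ 2 \<le> b} \<inter>
    {p. c \<le> p $ 2} \<inter> {p. p $ 2 \<le> d}"
    by (auto simp: base_box_def)
  then show ?thesis
    by (auto intro!: closed_Int closed_cbox closed_Collect_le continuous_intros)
qed

text \<open>The one-sided bound keeps shifted points inside a box whose lower edge meets a corner of the leaf.\<close>

definition shift_levels :: "real \<Rightarrow> real \<Rightarrow> nat \<Rightarrow> real set" where
  "shift_levels r e n = {t. 0 < t \<and> t < 1/4 \<and> (\<exists>m::int. r < real n * t - 3 * (1 - 3 * t) * of_int m \<and>
      real n * t - 3 * (1 - 3 * t) * of_int m < r + e)}"

lemma open_shift_levels: "open (shift_levels r e n)"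
proof -
  have "shift_levels r e n = {0<..<1/4} \<inter> (\<Union>m::int. {t. r < real n * t - 3 * (1 - 3 * t) * of_int m} \<inter>
      {t. real n * t - 3 * (1 - 3 * t) * of_int m < r + e})"
    by (auto simp: shift_levels_def)
  then show ?thesis by (auto intro!: open_Int open_UN open_Collect_less continuous_intros)
qed

lemma irrational_in_shift_levels:
  assumes "t \<notin> \<rat>" "0 < t" "t < 1/4" "e > 0"
  shows "\<exists>n. t \<in> shift_levels r e n"
proof -
  \<comment> \<open>Aiming at the midpoint of the window turns the two-sided estimate into the
    required one-sided one.\<close>
  obtain n :: nat and m :: int where "\<bar>real n * t - 3 * (1 - 3 * t) * of_int m - (r + e / 2)\<bar> < e / 2"
    using irrational_leaf_dense[OF assms(1-3), of "e / 2" "r + e / 2"] assms(4) by auto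
  then have "r < real n * t - 3 * (1 - 3 * t) * of_int m \<and> real n * t - 3 * (1 - 3 * t) * of_int m < r + e"
    by linarith
  then show ?thesis using assms(2,3) by (auto simp: shift_levels_def)
qed

lemma twist_power_shift:
  assumes "t \<in> shift_levels r e n"
  obtains w where "r < w" "w < r + e" "\<And>s. (twist ^^ n) (leaf t s) = leaf t (s + w)"
proof -
  have t: "0 < t" "t < 1/4" using assms by (auto simp: shift_levels_def)
  obtain m :: int where m: "r < real n * t - 3 * (1 - 3 * t) * of_int m" "real n * t - 3 * (1 - 3 * t) * of_int m < r + e"
    using assms by (auto simp: shift_levels_def)
  define w where "w = real n * t - 3 * (1 - 3 * t) * of_int m"
  have "(twist ^^ n) (leaf t s) = leaf t (s + w)" for s
  proof -
    have "s + real n * t = (s + w) + 3 * (1 - 3 * t) * of_int m" by (simp add: w_def)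
    then show ?thesis by (simp only: twist_power_leaf[OF t] leaf_add_period[OF t(2)])
  qed
  then show ?thesis using that m by (auto simp: w_def)
qed

text \<open>The 9 keeps every enlargement below 1/8, the bound under which the shift estimates are
  proved.\<close>

lemma le_of_all_enlargements:
  assumes "\<And>n::nat. x \<le> c + 1 / (real n + 9)"
  shows "x \<le> (c::real)"
proof (rule field_le_epsilon)
  fix e :: real assume e: "0 < e"
  obtain n :: nat where "1 / e < real n" using reals_Archimedean2 by blast
  then have "1 < e * real n" using e by (simp add: mult.commute pos_divide_less_eq)
  then have "1 \<le> e * (real n + 9)" using e by (simp add: distrib_left)
  then have "1 / (real n + 9) \<le> e" by (simp add: pos_divide_le_eq)
  then show "x \<le> c + e" using assms[of n] by simp
qed

context unimodular_measure
begin

lemma rational_level_set_null: "rational_level_set \<in> null_sets M"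
proof -
  define L where "L = (\<Union>h \<in> {(a :: int, b :: int, c :: int). a \<noteq> 0 \<or> b \<noteq> 0}. {p \<in> unit_square. form_at h p = 0})"
  have "L \<in> null_sets M" unfolding L_def
  proof (rule null_sets_UN')
    show "countable {(a :: int, b :: int, c :: int). a \<noteq> 0 \<or> b \<noteq> 0}" by (rule countableI_type)
    fix h assume "h \<in> {(a :: int, b :: int, c :: int). a \<noteq> 0 \<or> b \<noteq> 0}"
    then obtain a b c where "h = (a, b, c)" "a \<noteq> 0 \<or> b \<noteq> 0" by auto
    then show "{p \<in> unit_square. form_at h p = 0} \<in> null_sets M"
      using line_null[of a b c] form_line_closed[of h, THEN borel_closed] by (simp add: null_sets_def sets_iff Collect_mono)
  qed
  moreover have "rational_level_set \<in> sets M"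
    using rational_level_set_borel by (auto simp: sets_iff rational_level_set_def)
  ultimately show ?thesis using null_sets_subset[of L M rational_level_set] rational_level_set_lines by (simp add: L_def)
qed

lemma preimage_sets:
  assumes S: "unimodular_involution ps S" and A: "A \<in> sets M"
  shows "S -` A \<inter> unit_square \<in> sets M"
proof -
  have "A \<in> sets borel" using A unfolding sets_iff by blast
  then have "S -` A \<inter> unit_square \<in> sets borel" by (rule unimodular_involution.preimage_sets[OF S])
  then show ?thesis unfolding sets_iff by blast
qed

lemma twist_invariant:
  assumes A: "A \<in> sets M"
  shows "twist -` A \<inter> unit_square \<in> sets M" "emeasure M (twist -` A \<inter> unit_square) = emeasure M A"
proof -
  have eq: "twist -` A \<inter> unit_square = coord_swap -` (leaf_flip -` A \<inter> unit_square) \<inter> unit_square"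
    using coord_swap.into_square by (auto simp: twist_def)
  have F: "leaf_flip -` A \<inter> unit_square \<in> sets M"
    by (rule preimage_sets[OF leaf_flip.unimodular_involution_axioms A])
  then show "twist -` A \<inter> unit_square \<in> sets M"
    unfolding eq by (rule preimage_sets[OF coord_swap.unimodular_involution_axioms])
  show "emeasure M (twist -` A \<inter> unit_square) = emeasure M A"
    unfolding eq using invariant[OF coord_swap.unimodular_involution_axioms F]
      invariant[OF leaf_flip.unimodular_involution_axioms A] by simp
qed

lemma twist_power_invariant:
  assumes A: "A \<in> sets M"
  shows "(twist ^^ n) -` A \<inter> unit_square \<in> sets M \<and> emeasure M ((twist ^^ n) -` A \<inter> unit_square) = emeasure M A"
proof (induction n)
  case 0
  then show ?case using A by (auto simp: sets_iff Int_absorb2)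
next
  case (Suc n)
  have eq: "(twist ^^ Suc n) -` A \<inter> unit_square = twist -` ((twist ^^ n) -` A \<inter> unit_square) \<inter> unit_square"
    using twist_in_square by (auto simp: funpow_swap1)
  show ?case unfolding eq
    using twist_invariant[OF conjunct1[OF Suc]] conjunct2[OF Suc] by simp
qed

text \<open>The exponent may depend on the level because the twist preserves levels.\<close>

lemma emeasure_le_by_twist:
  assumes Q: "Q \<in> sets M" and Q': "Q' \<in> sets M" and C: "\<And>n. C n \<in> sets borel" "\<And>n. C n \<subseteq> {0<..<1/4}"
    and hit: "\<And>p. p \<in> Q \<Longrightarrow> level p \<notin> \<rat> \<Longrightarrow> \<exists>n. level p \<in> C n"
    and move: "\<And>n p. p \<in> Q \<Longrightarrow> level p \<in> C n \<Longrightarrow> (twist ^^ n) p \<in> Q'"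
  shows "emeasure M Q \<le> emeasure M Q'"
proof -
  \<comment> \<open>Each level is assigned to the first exponent that suits it.\<close>
  define D where "D = disjointed C"
  define X where "X n = level -` D n \<inter> unit_square" for n
  have D: "D n \<in> sets borel" "D n \<subseteq> C n" for n
    using sets.range_disjointed_sets'[of C borel] C(1) disjointed_subset[of C n] by (auto simp: D_def)
  have "(\<Union>n. D n) = (\<Union>n. C n)" by (simp add: D_def UN_disjointed_eq)
  have "disjoint_family D" unfolding D_def by (rule disjoint_family_disjointed)
  then have disj: "disjoint_family X" by (auto simp: disjoint_family_on_def X_def)
  have X: "X n \<in> sets M" for n
    using measurable_sets[OF borel_measurable_level D(1)] by (auto simp: X_def sets_iff)
  have sub: "Q - rational_level_set \<subseteq> (\<Union>n. Q \<inter> X n)"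
  proof
    fix p assume p: "p \<in> Q - rational_level_set"
    then have "p \<in> unit_square" using Q by (auto simp: sets_iff)
    then have "\<exists>n. level p \<in> C n" using p hit by (auto simp: rational_level_set_def)
    then have "\<exists>n. level p \<in> D n" using \<open>(\<Union>n. D n) = (\<Union>n. C n)\<close> by blast
    then show "p \<in> (\<Union>n. Q \<inter> X n)" using p \<open>p \<in> unit_square\<close> by (auto simp: X_def)
  qed
  \<comment> \<open>Intersecting the target with \<open>X n\<close> as well keeps the targets for
    different exponents disjoint, so the estimates can be summed.\<close>
  have le: "emeasure M (Q \<inter> X n) \<le> emeasure M (Q' \<inter> X n)" for n
  proof -
    have "Q \<inter> X n \<subseteq> (twist ^^ n) -` (Q' \<inter> X n) \<inter> unit_square"
    proof
      fix p assume p: "p \<in> Q \<inter> X n"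
      then have "level p \<in> C n" "p \<in> unit_square" "level p \<in> D n" using D(2) by (auto simp: X_def)
      moreover from this have "0 < level p" "level p < 1/4" using C(2) by fastforce+
      ultimately show "p \<in> (twist ^^ n) -` (Q' \<inter> X n) \<inter> unit_square"
        using p move level_twist_power[of p n] twist_power_in_square by (auto simp: X_def)
    qed
    then have "emeasure M (Q \<inter> X n) \<le> emeasure M ((twist ^^ n) -` (Q' \<inter> X n) \<inter> unit_square)"
      using twist_power_invariant[of "Q' \<inter> X n" n] Q' X by (intro emeasure_mono) auto
    then show ?thesis using twist_power_invariant[of "Q' \<inter> X n" n] Q' X by auto
  qed
  have "emeasure M Q = emeasure M (Q - rational_level_set)"
    using emeasure_Diff_null_set[OF rational_level_set_null Q] by simp
  also have "\<dots> \<le> emeasure M (\<Union>n. Q \<inter> X n)" by (rule emeasure_mono[OF sub]) (use Q X in auto)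
  also have "\<dots> = (\<Sum>n. emeasure M (Q \<inter> X n))"
    by (rule suminf_emeasure[symmetric]) (use Q X disj in \<open>auto simp: disjoint_family_on_def\<close>)
  also have "\<dots> \<le> (\<Sum>n. emeasure M (Q' \<inter> X n))" by (rule suminf_le) (use le in auto)
  also have "\<dots> = emeasure M (\<Union>n. Q' \<inter> X n)"
    by (rule suminf_emeasure) (use Q' X disj in \<open>auto simp: disjoint_family_on_def\<close>)
  also have "\<dots> \<le> emeasure M Q'" by (rule emeasure_mono) (use Q' in auto)
  finally show ?thesis .
qed

lemma hyp_box_sets: "hyp_box a b c d \<in> sets M"
  using closed_hyp_box borel_closed by (auto simp: sets_iff hyp_box_def)

lemma base_box_sets: "base_box a b c d \<in> sets M"
  using closed_base_box borel_closed by (auto simp: sets_iff base_box_def)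

lemma emeasure_base_box: "emeasure M (base_box a b c d) = emeasure M (hyp_box a b c d)"
  using invariant[OF mirror.unimodular_involution_axioms base_box_sets] by (simp add: mirror_base_box)

text \<open>Continuity from above, available by finiteness, lets the error \<open>e\<close> of a
  shift tend to 0.\<close>

lemma le_of_enlargements:
  assumes "\<And>e. 0 < e \<Longrightarrow> e < 1/8 \<Longrightarrow> v \<le> emeasure M (B e)" and B: "\<And>e. B e \<in> sets M"
    and mono: "\<And>d e. d \<le> e \<Longrightarrow> B d \<subseteq> B e" and inter: "(\<Inter>n::nat. B (1 / (real n + 9))) \<subseteq> B 0"
  shows "v \<le> emeasure M (B 0)"
proof -
  let ?e = "\<lambda>n::nat. 1 / (real n + 9)"
  have "B (?e n) \<subseteq> B (?e m)" if "m \<le> n" for m n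
    by (rule mono, rule frac_le) (use that in simp_all)
  then have dec: "decseq (\<lambda>n. B (?e n))" by (simp add: decseq_def)
  have "(\<lambda>n. emeasure M (B (?e n))) \<longlonglongrightarrow> emeasure M (\<Inter>n. B (?e n))"
  proof (rule Lim_emeasure_decseq[OF _ dec])
    show "range (\<lambda>n. B (?e n)) \<subseteq> sets M" using B by blast
    show "emeasure M (B (?e n)) \<noteq> \<infinity>" for n using finite_measure[of "B (?e n)"] by simp
  qed
  moreover have "v \<le> emeasure M (B (?e n))" for n
  proof (rule assms(1))
    show "1 / (real n + 9) < 1/8" by (rule less_le_trans[of _ "1 / (real n + 8)"]) (simp_all add: frac_less2 frac_le)
  qed simp
  ultimately have "v \<le> emeasure M (\<Inter>n. B (?e n))" by (intro LIMSEQ_le_const) auto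
  also have "\<dots> \<le> emeasure M (B 0)" using inter B by (rule emeasure_mono)
  finally show ?thesis .
qed

text \<open>The level is \<open>z \<le> 1/8\<close>, so the hypotenuse edge of the leaf has length
  at least 5/8, and \<open>b \<le> c\<close>, \<open>b \<le> c + r\<close> ensure
  \<open>z \<le> y\<close> before and after the shift. Point and image therefore lie on this edge,
  where moving by \<open>w\<close> adds \<open>w\<close> to \<open>y\<close> and keeps
  \<open>z\<close>.\<close>

lemma hyp_box_shift_le:
  assumes "0 \<le> a" "b \<le> 1/8" "b \<le> c" "b \<le> c + r" "d \<le> 1/4" "d + r \<le> 1/4"
  shows "emeasure M (hyp_box a b c d) \<le> emeasure M (hyp_box a b (c + r) (d + r))"
proof -
  \<comment> \<open>Only the upper side is enlarged, because the actual shift lies strictly between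
    \<open>r\<close> and \<open>r + e\<close>.\<close>
  define B where "B e = hyp_box a b (c + r) (d + r + e)" for e
  have "emeasure M (hyp_box a b c d) \<le> emeasure M (B e)" if e: "0 < e" "e < 1/8" for e
  proof (rule emeasure_le_by_twist[of _ _ "shift_levels r e"])
    show "hyp_box a b c d \<in> sets M" "B e \<in> sets M" by (auto simp: B_def hyp_box_sets)
    show "shift_levels r e n \<in> sets borel" "shift_levels r e n \<subseteq> {0<..<1/4}" for n
      using open_shift_levels by (auto simp: shift_levels_def)
    fix p assume p: "p \<in> hyp_box a b c d"
    define t where "t = 1 - p $ 1 - p $ 2"
    have lev: "level p = t" and t: "a \<le> t" "t \<le> b" using p assms by (auto simp: hyp_box_def level_def t_def)
    show "\<exists>n. level p \<in> shift_levels r e n" if "level p \<notin> \<rat>"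
    proof (rule irrational_in_shift_levels)
      have "t \<noteq> 0" using that lev by auto
      then show "0 < level p" "level p < 1/4" using t assms lev by auto
    qed (use that e in auto)
    fix n assume n: "level p \<in> shift_levels r e n"
    then have t4: "0 < t" "t < 1/4" using lev by (auto simp: shift_levels_def)
    obtain w where w: "r < w" "w < r + e" "\<And>s. (twist ^^ n) (leaf t s) = leaf t (s + w)"
      using twist_power_shift n lev by metis
    have y: "c \<le> p $ 2" "p $ 2 \<le> d" using p by (auto simp: hyp_box_def)
    have "p = leaf t (1 - 3 * t + (p $ 2 - t))"
      using t4 t y assms by (subst leaf_hypotenuse) (auto simp: vec2_eq_iff t_def)
    then have "(twist ^^ n) p = leaf t (1 - 3 * t + (p $ 2 - t + w))" using w(3) by (metis add.assoc)
    also have "\<dots> = vector [1 - 2 * t - (p $ 2 - t + w), t + (p $ 2 - t + w)]"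
      using t4 t y w assms e by (intro leaf_hypotenuse) auto
    finally have "(twist ^^ n) p = vector [1 - t - p $ 2 - w, p $ 2 + w]" by (simp add: algebra_simps)
    moreover have "(twist ^^ n) p \<in> unit_square" using p twist_power_in_square by (auto simp: hyp_box_def)
    ultimately show "(twist ^^ n) p \<in> B e" using t y w by (auto simp: B_def hyp_box_def)
  qed
  then have "emeasure M (hyp_box a b c d) \<le> emeasure M (B 0)"
  proof (rule le_of_enlargements)
    show "B e \<in> sets M" for e by (simp add: B_def hyp_box_sets)
    show "B d' \<subseteq> B e" if "d' \<le> e" for d' e using that by (auto simp: B_def hyp_box_def)
    show "(\<Inter>n::nat. B (1 / (real n + 9))) \<subseteq> B 0"
      using le_of_all_enlargements by (auto simp: B_def hyp_box_def)
  qed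
  then show ?thesis by (simp add: B_def)
qed

text \<open>Here \<open>y\<close> is the level and \<open>x - y\<close> the leaf parameter. The
  shifted parameter stays below \<open>1/8 + 1/8\<close>, less than the edge length
  \<open>1 - 3 * y\<close> when \<open>y < 1/4\<close>, and \<open>0 \<le> a + r\<close> keeps it
  from passing the corner.\<close>

lemma base_box_shift_le:
  assumes "0 \<le> a" "0 \<le> a + r" "b \<le> 1/8" "b + r \<le> 1/8" "0 \<le> c" "d \<le> 1/4"
  shows "emeasure M (base_box a b c d) \<le> emeasure M (base_box (a + r) (b + r) c d)"
proof -
  define B where "B e = base_box (a + r) (b + r + e) c d" for e
  have "emeasure M (base_box a b c d) \<le> emeasure M (B e)" if e: "0 < e" "e < 1/8" for e
  proof (rule emeasure_le_by_twist[of _ _ "shift_levels r e"])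
    show "base_box a b c d \<in> sets M" "B e \<in> sets M" by (auto simp: B_def base_box_sets)
    show "shift_levels r e n \<in> sets borel" "shift_levels r e n \<subseteq> {0<..<1/4}" for n
      using open_shift_levels by (auto simp: shift_levels_def)
    fix p assume p: "p \<in> base_box a b c d"
    define t where "t = p $ 2"
    have lev: "level p = t" and t: "c \<le> t" "t \<le> d" using p assms by (auto simp: base_box_def level_def t_def)
    show "\<exists>n. level p \<in> shift_levels r e n" if "level p \<notin> \<rat>"
    proof (rule irrational_in_shift_levels)
      \<comment> \<open>The box may touch the levels 0 and 1/4, which lie outside the range of
        \<open>twist_power_leaf\<close>; both are rational and so already excluded.\<close>
      have "(1/4 :: real) \<in> \<rat>" by (intro Rats_divide) auto
      then have "t \<noteq> 0" "t \<noteq> 1/4" using that lev Rats_0 by metis+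
      then show "0 < level p" "level p < 1/4" using t assms lev by auto
    qed (use that e in auto)
    fix n assume n: "level p \<in> shift_levels r e n"
    then have t4: "0 < t" "t < 1/4" using lev by (auto simp: shift_levels_def)
    obtain w where w: "r < w" "w < r + e" "\<And>s. (twist ^^ n) (leaf t s) = leaf t (s + w)"
      using twist_power_shift n lev by metis
    have x: "a \<le> p $ 1 - t" "p $ 1 - t \<le> b" using p by (auto simp: base_box_def t_def)
    have "p = leaf t (p $ 1 - t)"
      using t4 t x assms by (subst leaf_bottom) (auto simp: vec2_eq_iff t_def)
    then have "(twist ^^ n) p = leaf t (p $ 1 - t + w)" using w(3) by metis
    also have "\<dots> = vector [t + (p $ 1 - t + w), t]"
      using t4 t x w assms e by (intro leaf_bottom) auto
    finally have "(twist ^^ n) p = vector [p $ 1 + w, t]" by simp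
    moreover have "(twist ^^ n) p \<in> unit_square" using p twist_power_in_square by (auto simp: base_box_def)
    ultimately show "(twist ^^ n) p \<in> B e" using t x w by (auto simp: B_def base_box_def)
  qed
  then have "emeasure M (base_box a b c d) \<le> emeasure M (B 0)"
  proof (rule le_of_enlargements)
    show "B e \<in> sets M" for e by (simp add: B_def base_box_sets)
    show "B d' \<subseteq> B e" if "d' \<le> e" for d' e using that by (auto simp: B_def base_box_def)
    show "(\<Inter>n::nat. B (1 / (real n + 9))) \<subseteq> B 0"
      using le_of_all_enlargements by (auto simp: B_def base_box_def)
  qed
  then show ?thesis by (simp add: B_def)
qed

text \<open>The shifts by \<open>r\<close> and by \<open>- r\<close> give the two
  inequalities.\<close>

lemma hyp_box_shift_vertical:
  assumes "0 \<le> a" "b \<le> 1/8" "b \<le> c" "b \<le> c + r" "d \<le> 1/4" "d + r \<le> 1/4"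
  shows "emeasure M (hyp_box a b (c + r) (d + r)) = emeasure M (hyp_box a b c d)"
  using hyp_box_shift_le[of a b c r d] hyp_box_shift_le[of a b "c + r" "- r" "d + r"] assms
  by (auto intro!: antisym)

text \<open>These boxes are shifted across their own leaves; in the mirror image this is a shift
  along horizontal leaves, and invariance under \<open>mirror\<close> transports it back.\<close>

lemma hyp_box_shift_horizontal:
  assumes "0 \<le> a" "0 \<le> a + r" "b \<le> 1/8" "b + r \<le> 1/8" "0 \<le> c" "d \<le> 1/4"
  shows "emeasure M (hyp_box (a + r) (b + r) c d) = emeasure M (hyp_box a b c d)"
  using base_box_shift_le[of a r b c d] base_box_shift_le[of "a + r" "- r" "b + r" c d] assms
  by (auto intro!: antisym simp: emeasure_base_box)

end

subsection \<open>Uniqueness\<close>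

text \<open>Additivity is asked at rational points only, because boxes can be split only along lines
  known to be null. It fixes \<open>f\<close> at rational multiples of \<open>L\<close>, and
  monotonicity leaves no other value in between.\<close>

lemma monotone_additive_linear:
  fixes f :: "real \<Rightarrow> real"
  assumes L: "L \<in> \<rat>" "0 < L"
    and mono: "\<And>a b. 0 \<le> a \<Longrightarrow> a \<le> b \<Longrightarrow> b \<le> L \<Longrightarrow> f a \<le> f b"
    and add: "\<And>a b. a \<in> \<rat> \<Longrightarrow> b \<in> \<rat> \<Longrightarrow> 0 \<le> a \<Longrightarrow> 0 \<le> b \<Longrightarrow> a + b \<le> L \<Longrightarrow> f (a + b) = f a + f b"
    and a: "0 \<le> a" "a \<le> L"
  shows "f a = a / L * f L"
proof -
  have f0: "f 0 = 0" using add[of 0 0] L by simp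
  have mult: "f (real k * c) = real k * f c" if c: "c \<in> \<rat>" "0 \<le> c" "real k * c \<le> L" for k c
    using c(3)
  proof (induction k)
    case (Suc k)
    have "real k * c \<in> \<rat>" using c(1) by (intro Rats_mult) auto
    moreover have "real k * c + c \<le> L" using Suc.prems by (simp add: distrib_right add.commute)
    moreover have "0 \<le> real k * c" using c(2) by simp
    ultimately have "f (real k * c + c) = f (real k * c) + f c" using c by (intro add)
    moreover have "f (real k * c) = real k * f c" using Suc.IH \<open>real k * c + c \<le> L\<close> c(2) by simp
    moreover have "real (Suc k) * c = real k * c + c" by (simp add: distrib_right)
    ultimately show ?case by (simp only: distrib_right of_nat_Suc mult_1 add.commute)
  qed (simp add: f0)
  have rat: "f (q * L) = q * f L" if q: "q \<in> \<rat>" "0 \<le> q" "q \<le> 1" for q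
  proof -
    obtain m n :: int where mn: "n > 0" "q = of_int m / of_int n" using q(1) by (metis Rats_cases')
    have "0 \<le> m" using q(2) mn by (simp add: zero_le_divide_iff)
    define c where "c = L / real (nat n)"
    have n: "real (nat n) = of_int n" "real (nat m) = of_int m" using mn(1) \<open>0 \<le> m\<close> by auto
    have c: "c \<in> \<rat>" "0 \<le> c" using L mn(1) by (auto simp: c_def intro!: Rats_divide)
    have nc: "real (nat n) * c = L" using mn(1) by (simp add: c_def)
    have mc: "real (nat m) * c = q * L" by (simp add: c_def n mn(2))
    have "f L = real (nat n) * f c" using mult[OF c, of "nat n"] nc by simp
    moreover have "f (q * L) = real (nat m) * f c"
      using mult[OF c, of "nat m"] mc q L by (simp add: mult_left_le_one_le)
    ultimately show ?thesis using mn by (simp add: n)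
  qed
  define s where "s = a / L"
  have s: "0 \<le> s" "s \<le> 1" "a = s * L" using a L by (auto simp: s_def)
  have nonneg: "0 \<le> f a" using mono[of 0 a] f0 a by simp
  have "f a \<le> f L" using mono[of a L] a by simp
  have "f a = s * f L"
  proof (cases "f L = 0")
    case True
    then show ?thesis using nonneg \<open>f a \<le> f L\<close> by simp
  next
    case False
    then have pos: "f L > 0" using nonneg \<open>f a \<le> f L\<close> by linarith
    define v where "v = f a / f L"
    have v: "0 \<le> v" "v \<le> 1" "f a = v * f L" using nonneg \<open>f a \<le> f L\<close> pos by (auto simp: v_def)
    have False if "v < s"
    proof -
      obtain q where q: "q \<in> \<rat>" "v < q" "q < s" using Rats_dense_in_real[OF \<open>v < s\<close>] by blast
      have "q * L \<le> a" using q(3) L(2) s(3) by (simp add: mult_right_mono)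
      then have "q * f L \<le> f a" using rat[of q] mono[of "q * L" a] q v s L a by simp
      then show False using q(2) v(3) pos by simp
    qed
    moreover have False if "s < v"
    proof -
      obtain q where q: "q \<in> \<rat>" "s < q" "q < v" using Rats_dense_in_real[OF \<open>s < v\<close>] by blast
      have "a \<le> q * L" using q(2) L(2) s(3) by (simp add: mult_right_mono)
      moreover have "q * L \<le> L" using q(3) v(2) L(2) by simp
      ultimately have "f a \<le> q * f L" using rat[of q] mono[of a "q * L"] q v s L a by simp
      then show False using q(3) v(3) pos by simp
    qed
    ultimately show ?thesis using v(3) by fastforce
  qed
  then show ?thesis by (simp add: s_def)
qed

section \<open>Comparison of two measures on the corner box\<close>

abbreviation corner_box :: "(real^2) set" where
  "corner_box \<equiv> hyp_box 0 (1/8) (1/8) (1/4)"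

text \<open>The affine involution \<open>(x, y) -> (z, y)\<close> turns hypotenuse boxes into
  rectangles parallel to the axes, so measures on the corner box can be compared on the sets
  \<open>{..u}\<close>.\<close>

definition box_coords :: "real^2 \<Rightarrow> real^2" where
  "box_coords = form_pair (-1, -1, 1) (0, 1, 0)"

lemma box_coords_nth [simp]: "box_coords p $ 1 = 1 - p $ 1 - p $ 2" "box_coords p $ 2 = p $ 2"
  by (auto simp: box_coords_def form_pair_def)

lemma box_coords_involution: "box_coords (box_coords p) = p"
  by (simp add: vec2_eq_iff)

lemma borel_measurable_box_coords: "box_coords \<in> borel_measurable borel"
  unfolding box_coords_def by (intro borel_measurable_continuous_onI continuous_on_form_pair)

context unimodular_measure
begin

lemma rational_line_null:
  assumes "a \<noteq> 0 \<or> b \<noteq> 0" "q \<in> \<rat>"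
  shows "{p \<in> unit_square. of_int a * p $ 1 + of_int b * p $ 2 = q} \<in> null_sets M"
proof -
  obtain m n :: int where q: "n > 0" "q = of_int m / of_int n" using assms(2) by (metis Rats_cases')
  have iff: "of_int a * p $ 1 + of_int b * p $ 2 = q \<longleftrightarrow> form_at (n * a, n * b, - m) p = 0" for p :: "real^2"
  proof -
    have "of_int a * p $ 1 + of_int b * p $ 2 = q \<longleftrightarrow>
        of_int n * (of_int a * p $ 1 + of_int b * p $ 2) = of_int m"
      unfolding q(2) using q(1) by (simp add: eq_divide_eq mult.commute)
    then show ?thesis by (simp add: algebra_simps)
  qed
  have "emeasure M {p \<in> unit_square. form_at (n * a, n * b, - m) p = 0} = 0"
    using assms(1) q(1) by (intro line_null) auto
  moreover have "{p \<in> unit_square. form_at (n * a, n * b, - m) p = 0} \<in> sets M"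
    using form_line_closed[of "(n * a, n * b, - m)", THEN borel_closed] unfolding sets_iff by blast
  ultimately show ?thesis unfolding iff by (rule null_setsI)
qed

lemma emeasure_hyp_box_split_horizontal:
  assumes "q \<in> \<rat>" "a \<le> q" "q \<le> b"
  shows "emeasure M (hyp_box a b c d) = emeasure M (hyp_box a q c d) + emeasure M (hyp_box q b c d)"
proof -
  have "hyp_box a b c d = hyp_box a q c d \<union> hyp_box q b c d" using assms by (auto simp: hyp_box_def)
  moreover have "hyp_box a q c d \<inter> hyp_box q b c d \<in> null_sets M"
  proof (rule null_sets_subset)
    show "{p \<in> unit_square. of_int (- 1) * p $ 1 + of_int (- 1) * p $ 2 = q - 1} \<in> null_sets M"
      using assms(1) by (intro rational_line_null) auto
  qed (auto simp: hyp_box_def intro!: sets.Int[OF hyp_box_sets hyp_box_sets, unfolded hyp_box_def])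
  ultimately show ?thesis by (simp only:) (intro emeasure_Un' hyp_box_sets)
qed

lemma emeasure_hyp_box_split_vertical:
  assumes "q \<in> \<rat>" "c \<le> q" "q \<le> d"
  shows "emeasure M (hyp_box a b c d) = emeasure M (hyp_box a b c q) + emeasure M (hyp_box a b q d)"
proof -
  have "hyp_box a b c d = hyp_box a b c q \<union> hyp_box a b q d" using assms by (auto simp: hyp_box_def)
  moreover have "hyp_box a b c q \<inter> hyp_box a b q d \<in> null_sets M"
  proof (rule null_sets_subset)
    show "{p \<in> unit_square. of_int 0 * p $ 1 + of_int 1 * p $ 2 = q} \<in> null_sets M"
      using assms(1) by (intro rational_line_null) auto
  qed (auto simp: hyp_box_def intro!: sets.Int[OF hyp_box_sets hyp_box_sets, unfolded hyp_box_def])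
  ultimately show ?thesis by (simp only:) (intro emeasure_Un' hyp_box_sets)
qed

lemma emeasure_eq: "emeasure M A = ennreal (measure M A)"
  using finite_measure[of A] by (simp add: emeasure_eq_ennreal_measure)

lemma measure_mono: "A \<subseteq> B \<Longrightarrow> B \<in> sets M \<Longrightarrow> measure M A \<le> measure M B"
  using emeasure_mono[of A B M] by (simp add: emeasure_eq)

lemma hyp_box_mono: "a' \<le> a \<Longrightarrow> b \<le> b' \<Longrightarrow> c' \<le> c \<Longrightarrow> d \<le> d' \<Longrightarrow>
    measure M (hyp_box a b c d) \<le> measure M (hyp_box a' b' c' d')"
  by (rule measure_mono[OF _ hyp_box_sets]) (auto simp: hyp_box_def)

text \<open>By the two shift lemmas the measure is additive in each side length separately, hence
  linear in each; 64 is the reciprocal of \<open>1/8 * 1/8\<close>.\<close>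

lemma measure_hyp_box:
  assumes a: "0 \<le> a" "a \<le> 1/8" and b: "0 \<le> b" "b \<le> 1/8"
  shows "measure M (hyp_box 0 a (1/8) (1/8 + b)) = 64 * a * b * measure M corner_box"
proof -
  have rat: "(1/8 :: real) \<in> \<rat>" by (intro Rats_divide) auto
  have "measure M (hyp_box 0 a (1/8) (1/8 + b)) = b / (1/8) * measure M (hyp_box 0 a (1/8) (1/8 + 1/8))"
  proof (rule monotone_additive_linear[OF rat _ _ _ b])
    fix u v :: real assume uv: "u \<in> \<rat>" "v \<in> \<rat>" "0 \<le> u" "0 \<le> v" "u + v \<le> 1/8"
    have "emeasure M (hyp_box 0 a (1/8) (1/8 + (u + v))) =
        emeasure M (hyp_box 0 a (1/8) (1/8 + u)) + emeasure M (hyp_box 0 a (1/8 + u) (1/8 + (u + v)))"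
      using uv rat by (intro emeasure_hyp_box_split_vertical Rats_add) auto
    also have "emeasure M (hyp_box 0 a (1/8 + u) (1/8 + (u + v))) = emeasure M (hyp_box 0 a (1/8) (1/8 + v))"
      using hyp_box_shift_vertical[of 0 a "1/8" u "1/8 + v"] a uv by (simp add: algebra_simps)
    finally show "measure M (hyp_box 0 a (1/8) (1/8 + (u + v))) =
        measure M (hyp_box 0 a (1/8) (1/8 + u)) + measure M (hyp_box 0 a (1/8) (1/8 + v))"
      by (simp add: emeasure_eq ennreal_plus[symmetric] del: ennreal_plus)
  qed (auto intro!: hyp_box_mono)
  also have "measure M (hyp_box 0 a (1/8) (1/8 + 1/8)) = a / (1/8) * measure M (hyp_box 0 (1/8) (1/8) (1/8 + 1/8))"
  proof (rule monotone_additive_linear[OF rat _ _ _ a])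
    fix u v :: real assume uv: "u \<in> \<rat>" "v \<in> \<rat>" "0 \<le> u" "0 \<le> v" "u + v \<le> 1/8"
    have "emeasure M (hyp_box 0 (u + v) (1/8) (1/8 + 1/8)) =
        emeasure M (hyp_box 0 u (1/8) (1/8 + 1/8)) + emeasure M (hyp_box u (u + v) (1/8) (1/8 + 1/8))"
      using uv by (intro emeasure_hyp_box_split_horizontal) auto
    also have "emeasure M (hyp_box u (u + v) (1/8) (1/8 + 1/8)) = emeasure M (hyp_box 0 v (1/8) (1/8 + 1/8))"
      using hyp_box_shift_horizontal[of 0 u v "1/8" "1/4"] uv by (simp add: add.commute)
    finally show "measure M (hyp_box 0 (u + v) (1/8) (1/8 + 1/8)) =
        measure M (hyp_box 0 u (1/8) (1/8 + 1/8)) + measure M (hyp_box 0 v (1/8) (1/8 + 1/8))"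
      by (simp add: emeasure_eq ennreal_plus[symmetric] del: ennreal_plus)
  qed (auto intro!: hyp_box_mono)
  finally show ?thesis by simp
qed

text \<open>The dependence on \<open>u\<close> is through a factor common to all such measures, so
  any two of them are proportional on these sets.\<close>

lemma emeasure_corner_box_atMost:
  "emeasure M (box_coords -` {..u} \<inter> corner_box) =
     ennreal (64 * max 0 (min (u $ 1) (1/8)) * max 0 (min (u $ 2) (1/4) - 1/8)) * emeasure M corner_box"
proof -
  have le_iff: "box_coords p \<le> u \<longleftrightarrow> 1 - p $ 1 - p $ 2 \<le> u $ 1 \<and> p $ 2 \<le> u $ 2" for p
    by (simp add: less_eq_vec_def forall_2)
  show ?thesis
  proof (cases "0 \<le> u $ 1 \<and> 1/8 \<le> u $ 2")
    case True
    define a b where "a = min (u $ 1) (1/8)" and "b = min (u $ 2) (1/4) - 1/8"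
    have ab: "0 \<le> a" "a \<le> 1/8" "0 \<le> b" "b \<le> 1/8" using True by (auto simp: a_def b_def)
    have "box_coords -` {..u} \<inter> corner_box = hyp_box 0 a (1/8) (1/8 + b)"
      by (auto simp: hyp_box_def le_iff a_def b_def)
    then show ?thesis
      using measure_hyp_box[OF ab] ab
      by (simp add: emeasure_eq a_def[symmetric] b_def[symmetric] ennreal_mult[symmetric] max_absorb2)
  next
    case False
    then have "box_coords -` {..u} \<inter> corner_box = {}" by (auto simp: hyp_box_def le_iff)
    moreover have "max 0 (min (u $ 1) (1/8)) * max 0 (min (u $ 2) (1/4) - 1/8) = 0"
      using False by (auto simp: min_def max_def)
    ultimately show ?thesis by (metis (no_types, opaque_lifting) emeasure_empty ennreal_0 mult.assoc mult_zero_left mult_zero_right)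
  qed
qed

text \<open>The factor \<open>c\<close> serves cross multiplication: each of two measures is scaled
  by the mass the other gives to the corner box, which avoids dividing by a mass not yet known to be
  positive.\<close>

definition box_image :: "ennreal \<Rightarrow> (real^2) measure" where
  "box_image c = scale_measure c (distr (restrict_space M corner_box) borel box_coords)"

lemma emeasure_box_image:
  assumes "A \<in> sets borel"
  shows "emeasure (box_image c) A = c * emeasure M (box_coords -` A \<inter> corner_box)"
proof -
  have box: "corner_box \<inter> space M = corner_box" by (auto simp: space_M hyp_box_def)
  have "box_coords \<in> measurable (restrict_space M corner_box) borel"
  proof (rule measurableI)
    fix X :: "(real^2) set" assume "X \<in> sets borel"
    then have "box_coords -` X \<in> sets borel" using measurable_sets[OF borel_measurable_box_coords] by simp
    then have "box_coords -` X \<inter> corner_box \<in> sets M"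
      using hyp_box_sets[of 0 "1/8" "1/8" "1/4"] unfolding sets_iff by blast
    then show "box_coords -` X \<inter> space (restrict_space M corner_box) \<in> sets (restrict_space M corner_box)"
      using hyp_box_sets[of 0 "1/8" "1/8" "1/4"] by (simp add: space_restrict_space sets_restrict_space_iff box)
  qed simp
  then have "emeasure (distr (restrict_space M corner_box) borel box_coords) A =
      emeasure (restrict_space M corner_box) (box_coords -` A \<inter> corner_box)"
    using assms by (simp add: emeasure_distr space_restrict_space box)
  also have "\<dots> = emeasure M (box_coords -` A \<inter> corner_box)"
    using hyp_box_sets by (intro emeasure_restrict_space) (auto simp: box)
  finally show ?thesis by (simp add: box_image_def)
qed

end

text \<open>The sets \<open>{..u}\<close> are closed under intersection and generate the Borel sets,
  so the two cross-multiplied images agree everywhere once they agree there.\<close>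

lemma corner_box_proportional:
  assumes M: "unimodular_measure M" and N: "unimodular_measure N"
    and A: "A \<in> sets borel" "A \<subseteq> corner_box"
  shows "emeasure N corner_box * emeasure M A = emeasure M corner_box * emeasure N A"
proof -
  interpret M: unimodular_measure M by (rule M)
  interpret N: unimodular_measure N by (rule N)
  let ?E = "range atMost :: (real^2) set set"
  have sets_borel: "sets borel = sigma_sets UNIV ?E"
    by (subst borel_eq_atMost) (simp add: sets_measure_of)
  have "M.box_image (emeasure N corner_box) = N.box_image (emeasure M corner_box)"
  proof (rule measure_eqI_generator_eq[where E = ?E and \<Omega> = UNIV])
    have "{..a} \<inter> {..b} = {..inf a b}" for a b :: "real^2" by auto
    then show "Int_stable ?E" by (auto simp: Int_stable_def)
    show "emeasure (M.box_image (emeasure N corner_box)) X = emeasure (N.box_image (emeasure M corner_box)) X"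
      if "X \<in> ?E" for X
      using that by (auto simp: M.emeasure_box_image N.emeasure_box_image M.emeasure_corner_box_atMost
          N.emeasure_corner_box_atMost mult_ac)
    show "sets (M.box_image (emeasure N corner_box)) = sigma_sets UNIV ?E"
      "sets (N.box_image (emeasure M corner_box)) = sigma_sets UNIV ?E"
      by (simp_all add: M.box_image_def N.box_image_def sets_borel)
    show "range (\<lambda>i::nat. {.. (\<chi> k. real i) :: real^2}) \<subseteq> ?E" by auto
    show "(\<Union>i::nat. {.. (\<chi> k. real i) :: real^2}) = UNIV"
    proof (intro equalityI subsetI)
      fix p :: "real^2"
      obtain i :: nat where "max (p $ 1) (p $ 2) \<le> real i" using real_arch_simple by blast
      then show "p \<in> (\<Union>i::nat. {.. (\<chi> k. real i) :: real^2})"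
        by (auto simp: less_eq_vec_def forall_2 intro!: exI[of _ i])
    qed simp
    show "emeasure (M.box_image (emeasure N corner_box)) {.. (\<chi> k. real i)} \<noteq> \<infinity>" for i :: nat
      using M.finite_measure N.finite_measure by (simp add: M.emeasure_box_image ennreal_mult_eq_top_iff less_top)
  qed auto
  moreover have "box_coords -` A \<in> sets borel"
    using measurable_sets[OF borel_measurable_box_coords A(1)] by simp
  moreover have "box_coords -` box_coords -` A \<inter> corner_box = A"
    using A(2) by (auto simp: box_coords_involution)
  ultimately show ?thesis
    using M.emeasure_box_image[of "box_coords -` A" "emeasure N corner_box"]
      N.emeasure_box_image[of "box_coords -` A" "emeasure M corner_box"] by simp
qed

section \<open>Covering the square by images of the corner box\<close>

lemma mirror_hyp_box: "mirror -` hyp_box a b c d \<inter> unit_square = base_box a b c d"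
  by (auto simp: hyp_box_def base_box_def mirror_def mem_unit_square)

text \<open>Leaves of level up to 1/8 cross the corner box along the hypotenuse. Higher ones miss
  it, since \<open>z \<le> 1/8\<close> there, but they cross its mirror image along the bottom edge.
  Density supplies a power that lands in the right stretch.\<close>

lemma orbit_meets_corner_box:
  assumes p: "p \<in> unit_square" and lev: "level p \<notin> \<rat>" "0 < level p" "level p < 1/4"
  shows "\<exists>n. (twist ^^ n) p \<in> corner_box \<or> (twist ^^ n) p \<in> base_box 0 (1/8) (1/8) (1/4)"
proof -
  define t where "t = level p"
  have t: "t \<notin> \<rat>" "0 < t" "t < 1/4" using lev by (auto simp: t_def)
  obtain s where s: "p = leaf t s" using on_leaf[OF lev(3)] by (auto simp: t_def)
  show ?thesis
  proof (cases "t \<le> 1/8")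
    case True
    \<comment> \<open>On the hypotenuse the point with second coordinate \<open>y\<close> has
      parameter \<open>1 - 4 * t + y\<close>; the window is thus
      \<open>1/8 < y < 1/4\<close>.\<close>
    obtain n where "t \<in> shift_levels (1 - 4 * t + 1/8 - s) (1/8) n"
      using irrational_in_shift_levels[OF t, of "1/8"] by auto
    then obtain w where w: "1 - 4 * t + 1/8 - s < w" "w < 1 - 4 * t + 1/8 - s + 1/8" "(twist ^^ n) p = leaf t (s + w)"
      using twist_power_shift s by metis
    define e where "e = s + w - (1 - 3 * t)"
    have "(twist ^^ n) p = leaf t (1 - 3 * t + e)" using w(3) by (simp add: e_def)
    also have "\<dots> = vector [1 - 2 * t - e, t + e]"
      using t w True by (intro leaf_hypotenuse) (auto simp: e_def)
    finally have "(twist ^^ n) p = vector [1 - 2 * t - e, t + e]" .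
    moreover have "(twist ^^ n) p \<in> unit_square" using p by (rule twist_power_in_square)
    ultimately have "(twist ^^ n) p \<in> corner_box" using t w True by (auto simp: hyp_box_def e_def)
    then show ?thesis by blast
  next
    case False
    obtain n where "t \<in> shift_levels (- s) (1/8) n"
      using irrational_in_shift_levels[OF t, of "1/8"] by auto
    then obtain w where w: "- s < w" "w < - s + 1/8" "(twist ^^ n) p = leaf t (s + w)"
      using twist_power_shift s by metis
    have "leaf t (s + w) = vector [t + (s + w), t]"
      using t w by (intro leaf_bottom) auto
    moreover have "(twist ^^ n) p \<in> unit_square" using p by (rule twist_power_in_square)
    ultimately have "(twist ^^ n) p \<in> base_box 0 (1/8) (1/8) (1/4)"
      using t w False by (auto simp: base_box_def)
    then show ?thesis by blast
  qed
qed

text \<open>An induction principle for hereditary properties stable under countable unions and the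
  involutions. It is kept abstract because it is used twice: for proportionality of two measures and
  for nullity.\<close>

lemma square_covered_by_corner_box:
  assumes sub: "\<And>U V. P U \<Longrightarrow> V \<subseteq> U \<Longrightarrow> V \<in> sets borel \<Longrightarrow> P V"
    and preimage: "\<And>U ps S. P U \<Longrightarrow> unimodular_involution ps S \<Longrightarrow> P (S -` U \<inter> unit_square)"
    and UN: "\<And>U :: nat \<Rightarrow> (real^2) set. (\<And>n. P (U n)) \<Longrightarrow> P (\<Union>n. U n)"
    and line: "\<And>a b c. a \<noteq> 0 \<or> b \<noteq> 0 \<Longrightarrow> P {p \<in> unit_square. form_at (a, b, c) p = 0}"
    and box: "P corner_box"
  shows "P unit_square"
proof -
  have Un: "P (U \<union> V)" if "P U" "P V" for U V
  proof -
    have "P (\<Union>n::nat. if n = 0 then U else V)" using that by (intro UN) auto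
    moreover have "(\<Union>n::nat. if n = 0 then U else V) = U \<union> V" by (auto split: if_splits)
    ultimately show ?thesis by simp
  qed
  have twist: "P (twist -` U \<inter> unit_square)" if "P U" for U
  proof -
    have "twist -` U \<inter> unit_square = coord_swap -` (leaf_flip -` U \<inter> unit_square) \<inter> unit_square"
      using coord_swap.into_square by (auto simp: twist_def)
    then show ?thesis
      using preimage[OF preimage[OF that leaf_flip.unimodular_involution_axioms] coord_swap.unimodular_involution_axioms]
      by simp
  qed
  have twist_power: "P ((twist ^^ n) -` U \<inter> unit_square)" if "P U" for U n
  proof (induction n)
    case 0
    \<comment> \<open>Applying an involution twice replaces \<open>U\<close> by its intersection
      with the square, without having to know that this is a Borel set.\<close>
    have "P (coord_swap -` (coord_swap -` U \<inter> unit_square) \<inter> unit_square)"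
      by (rule preimage[OF preimage[OF that coord_swap.unimodular_involution_axioms] coord_swap.unimodular_involution_axioms])
    moreover have "coord_swap -` (coord_swap -` U \<inter> unit_square) \<inter> unit_square = U \<inter> unit_square"
      using coord_swap.into_square coord_swap.involution by auto
    ultimately show ?case by simp
  next
    case (Suc n)
    have eq: "(twist ^^ Suc n) -` U \<inter> unit_square = twist -` ((twist ^^ n) -` U \<inter> unit_square) \<inter> unit_square"
      using twist_in_square by (auto simp: funpow_swap1)
    show ?case unfolding eq by (rule twist[OF Suc])
  qed
  \<comment> \<open>All integral forms are enumerated through \<open>from_nat\<close>; the
    degenerate ones contribute the empty set.\<close>
  define lines where "lines n = (case from_nat n of (a, b, c) \<Rightarrow>
      if a \<noteq> 0 \<or> b \<noteq> 0 then {p \<in> unit_square. form_at (a, b, c) p = 0} else {})" for n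
  have "P (lines n)" for n
    using line sub[OF box, of "{}"] by (cases "from_nat n :: form") (auto simp: lines_def)
  then have P_lines: "P (\<Union>n. lines n)" by (rule UN)
  have in_lines: "p \<in> (\<Union>n. lines n)" if "p \<in> unit_square" "a \<noteq> 0 \<or> b \<noteq> 0" "form_at (a, b, c) p = 0" for p a b c
    by (rule UN_I[of "to_nat (a, b, c)"]) (use that in \<open>simp_all add: lines_def\<close>)
  \<comment> \<open>\<open>O1\<close> is the open triangle without its core; \<open>O2\<close>,
    \<open>O3\<close>, \<open>O4\<close> are its copies in the other three half squares cut off by a
    diagonal.\<close>
  define O1 where "O1 = {p \<in> unit_square. 0 < level p \<and> level p < 1/4}"
  define O2 where "O2 = mirror -` O1 \<inter> unit_square"
  define O3 where "O3 = coord_swap -` O2 \<inter> unit_square"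
  define O4 where "O4 = mirror -` O3 \<inter> unit_square"
  have "P O1"
  proof (rule sub)
    show "P ((\<Union>n. lines n) \<union> ((\<Union>n. (twist ^^ n) -` corner_box \<inter> unit_square) \<union>
        (\<Union>n. (twist ^^ n) -` base_box 0 (1/8) (1/8) (1/4) \<inter> unit_square)))"
    proof (intro Un)
      show "P (\<Union>n. lines n)" by (rule P_lines)
      show "P (\<Union>n. (twist ^^ n) -` corner_box \<inter> unit_square)"
        by (rule UN) (rule twist_power[OF box])
      have "P (base_box 0 (1/8) (1/8) (1/4))"
        using preimage[OF box mirror.unimodular_involution_axioms] by (simp add: mirror_hyp_box)
      then show "P (\<Union>n. (twist ^^ n) -` base_box 0 (1/8) (1/8) (1/4) \<inter> unit_square)"
        by (intro UN twist_power)
    qed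
    show "O1 \<subseteq> (\<Union>n. lines n) \<union> ((\<Union>n. (twist ^^ n) -` corner_box \<inter> unit_square) \<union>
        (\<Union>n. (twist ^^ n) -` base_box 0 (1/8) (1/8) (1/4) \<inter> unit_square))"
    proof
      fix p assume p: "p \<in> O1"
      show "p \<in> (\<Union>n. lines n) \<union> ((\<Union>n. (twist ^^ n) -` corner_box \<inter> unit_square) \<union>
        (\<Union>n. (twist ^^ n) -` base_box 0 (1/8) (1/8) (1/4) \<inter> unit_square))"
      proof (cases "level p \<in> \<rat>")
        case True
        then have "p \<in> rational_level_set" using p by (auto simp: rational_level_set_def O1_def)
        then obtain h where h: "h \<in> {(a, b, c). a \<noteq> 0 \<or> b \<noteq> 0}" "p \<in> unit_square" "form_at h p = 0"
          using subsetD[OF rational_level_set_lines] by blast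
        then show ?thesis using in_lines by (cases h) auto
      next
        case False
        then show ?thesis using p orbit_meets_corner_box[of p] by (auto simp: O1_def)
      qed
    qed
    have "O1 = level -` {0<..<1/4} \<inter> unit_square" by (auto simp: O1_def)
    then show "O1 \<in> sets borel" using measurable_sets[OF borel_measurable_level, of "{0<..<1/4}"] by simp
  qed
  have O2: "P O2"
    unfolding O2_def by (rule preimage[OF \<open>P O1\<close> mirror.unimodular_involution_axioms])
  have O3: "P O3"
    unfolding O3_def by (rule preimage[OF O2 coord_swap.unimodular_involution_axioms])
  have O4: "P O4"
    unfolding O4_def by (rule preimage[OF O3 mirror.unimodular_involution_axioms])
  have "P (((\<Union>n. lines n) \<union> O1) \<union> (O2 \<union> (O3 \<union> O4)))"
    by (intro Un P_lines \<open>P O1\<close> O2 O3 O4)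
  moreover have "unit_square \<subseteq> ((\<Union>n. lines n) \<union> O1) \<union> (O2 \<union> (O3 \<union> O4))"
  proof
    fix p :: "real^2" assume p: "p \<in> unit_square"
    define x y where "x = p $ 1" and "y = p $ 2"
    have sq: "0 \<le> x" "x \<le> 1" "0 \<le> y" "y \<le> 1" using p by (auto simp: x_def y_def mem_unit_square)
    have mem_O1: "q \<in> O1 \<longleftrightarrow> q \<in> unit_square \<and> (0 < q $ 1 \<and> 0 < q $ 2 \<and> 0 < 1 - q $ 1 - q $ 2) \<and>
        (q $ 1 < 1/4 \<or> q $ 2 < 1/4 \<or> 1 - q $ 1 - q $ 2 < 1/4)" for q
      unfolding O1_def level_def min_less_iff_conj min_less_iff_disj by blast
    have O1: "p \<in> O1 \<longleftrightarrow> (0 < x \<and> 0 < y \<and> 0 < 1 - x - y) \<and> (x < 1/4 \<or> y < 1/4 \<or> 1 - x - y < 1/4)"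
      using p by (simp add: mem_O1 x_def y_def)
    have O2: "p \<in> O2 \<longleftrightarrow> (0 < 1 - x \<and> 0 < y \<and> 0 < x - y) \<and> (1 - x < 1/4 \<or> y < 1/4 \<or> x - y < 1/4)"
      using p by (auto simp: O2_def mem_O1 x_def y_def mirror_def mem_unit_square)
    have O3: "p \<in> O3 \<longleftrightarrow> (0 < 1 - y \<and> 0 < x \<and> 0 < y - x) \<and> (1 - y < 1/4 \<or> x < 1/4 \<or> y - x < 1/4)"
      using p by (auto simp: O3_def O2_def mem_O1 x_def y_def mirror_def coord_swap_def mem_unit_square)
    have O4: "p \<in> O4 \<longleftrightarrow> (0 < 1 - y \<and> 0 < 1 - x \<and> 0 < x + y - 1) \<and> (1 - y < 1/4 \<or> 1 - x < 1/4 \<or> x + y - 1 < 1/4)"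
      using p by (auto simp: O4_def O3_def O2_def mem_O1 x_def y_def mirror_def coord_swap_def mem_unit_square)
    show "p \<in> ((\<Union>n. lines n) \<union> O1) \<union> (O2 \<union> (O3 \<union> O4))"
    \<comment> \<open>Besides the boundary and the diagonals, the lines \<open>x = 1/2\<close> and
      \<open>y = 1/2\<close> are set aside: they contain the four remaining points that lie in none
      of the copies.\<close>
    proof (cases "x = 0 \<or> x = 1 \<or> y = 0 \<or> y = 1 \<or> x + y = 1 \<or> x = y \<or> x = 1/2 \<or> y = 1/2")
      case True
      then have "p \<in> (\<Union>n. lines n)"
        using in_lines[OF p, of 1 0 0] in_lines[OF p, of 1 0 "-1"] in_lines[OF p, of 0 1 0]
          in_lines[OF p, of 0 1 "-1"] in_lines[OF p, of 1 1 "-1"] in_lines[OF p, of 1 "-1" 0]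
          in_lines[OF p, of 2 0 "-1"] in_lines[OF p, of 0 2 "-1"]
        by (auto simp: x_def y_def)
      then show ?thesis by simp
    next
      case False
      then have pos: "0 < x" "x < 1" "0 < y" "y < 1" using sq by auto
      have ne: "x \<noteq> 1/2" "y \<noteq> 1/2" using False by auto
      consider "x + y < 1" "y < x" | "x + y < 1" "x < y" | "1 < x + y" "y < x" | "1 < x + y" "x < y"
        using False by linarith
      then show ?thesis
      proof cases
        case 1
        \<comment> \<open>Since \<open>2 * y + (1 - x - y) + (x - y) = 1\<close>, three terms of at
          least 1/4 would all equal 1/4, forcing \<open>x = 1/2\<close>. The other cases are
          symmetric.\<close>
        have "y < 1/4 \<or> 1 - x - y < 1/4 \<or> x - y < 1/4" using ne 1 by linarith
        then have "p \<in> O1 \<or> p \<in> O2" unfolding O1 O2 using 1 pos by auto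
        then show ?thesis by blast
      next
        case 2
        have "x < 1/4 \<or> 1 - x - y < 1/4 \<or> y - x < 1/4" using ne 2 by linarith
        then have "p \<in> O1 \<or> p \<in> O3" unfolding O1 O3 using 2 pos by auto
        then show ?thesis by blast
      next
        case 3
        have "1 - x < 1/4 \<or> x + y - 1 < 1/4 \<or> x - y < 1/4" using ne 3 by linarith
        then have "p \<in> O4 \<or> p \<in> O2" unfolding O4 O2 using 3 pos by auto
        then show ?thesis by blast
      next
        case 4
        have "1 - y < 1/4 \<or> x + y - 1 < 1/4 \<or> y - x < 1/4" using ne 4 by linarith
        then have "p \<in> O4 \<or> p \<in> O3" unfolding O4 O3 using 4 pos by auto
        then show ?thesis by blast
      qed
    qed
  qed
  ultimately show ?thesis by (rule sub) auto
qed

lemma unimodular_measure_unique: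
  assumes M: "unimodular_measure M" and N: "unimodular_measure N"
  shows "M = N"
proof -
  interpret M: unimodular_measure M by (rule M)
  interpret N: unimodular_measure N by (rule N)
  have sets_eq: "A \<in> sets N \<longleftrightarrow> A \<in> sets M" for A unfolding M.sets_iff N.sets_iff ..
  define m n where "m = emeasure M corner_box" and "n = emeasure N corner_box"
  \<comment> \<open>Demanding proportionality on every measurable subset makes the property
    hereditary, as the covering principle requires.\<close>
  define P where "P U \<longleftrightarrow> U \<in> sets M \<and> (\<forall>A\<in>sets M. A \<subseteq> U \<longrightarrow> n * emeasure M A = m * emeasure N A)" for U
  have "P unit_square"
  proof (rule square_covered_by_corner_box)
    show "P V" if "P U" "V \<subseteq> U" "V \<in> sets borel" for U V
      using that unfolding P_def M.sets_iff by (metis order_trans)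
    show "P (S -` U \<inter> unit_square)" if U: "P U" and S: "unimodular_involution ps S" for U ps S
      unfolding P_def
    proof (intro conjI ballI impI)
      interpret S: unimodular_involution ps S by (rule S)
      have "U \<in> sets M" using U by (simp add: P_def)
      then show "S -` U \<inter> unit_square \<in> sets M" by (rule M.preimage_sets[OF S])
      fix A assume A: "A \<in> sets M" "A \<subseteq> S -` U \<inter> unit_square"
      have SA: "S -` A \<inter> unit_square \<in> sets M" using A(1) by (rule M.preimage_sets[OF S])
      have "S -` A \<inter> unit_square \<subseteq> U"
      proof
        fix q assume q: "q \<in> S -` A \<inter> unit_square"
        then have "S (S q) \<in> U" using A(2) by auto
        then show "q \<in> U" using q S.involution by simp
      qed
      then have "n * emeasure M (S -` A \<inter> unit_square) = m * emeasure N (S -` A \<inter> unit_square)"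
        using U SA by (simp add: P_def)
      then show "n * emeasure M A = m * emeasure N A"
        using M.invariant[OF S A(1)] N.invariant[OF S] A(1) by (simp add: sets_eq)
    qed
    show "P (\<Union>k. U k)" if U: "\<And>k. P (U k)" for U :: "nat \<Rightarrow> (real^2) set"
      unfolding P_def
    proof (intro conjI ballI impI)
      have Us: "range U \<subseteq> sets M" using U by (auto simp: P_def)
      then show "(\<Union>k. U k) \<in> sets M" by (rule sets.countable_UN)
      fix A assume A: "A \<in> sets M" "A \<subseteq> (\<Union>k. U k)"
      define D where "D k = A \<inter> disjointed U k" for k
      have D: "D k \<in> sets M" for k
        using sets.range_disjointed_sets[OF Us] A(1) by (auto simp: D_def)
      have "A = (\<Union>k. D k)" using A(2) UN_disjointed_eq[of U] by (auto simp: D_def)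
      moreover have "disjoint_family D"
        using disjoint_family_disjointed[of U] by (auto simp: D_def disjoint_family_on_def)
      moreover have "n * emeasure M (D k) = m * emeasure N (D k)" for k
        using U[of k] D[of k] disjointed_subset[of U k] by (auto simp: P_def D_def)
      moreover have "(\<Sum>k. n * emeasure M (D k)) = n * emeasure M (\<Union>k. D k)"
        if "disjoint_family D"
        using suminf_emeasure[of D M] D that by (simp add: image_subset_iff ennreal_suminf_cmult)
      moreover have "(\<Sum>k. m * emeasure N (D k)) = m * emeasure N (\<Union>k. D k)"
        if "disjoint_family D"
        using suminf_emeasure[of D N] D that by (simp add: image_subset_iff sets_eq ennreal_suminf_cmult)
      ultimately show "n * emeasure M A = m * emeasure N A" by simp
    qed
    show "P {p \<in> unit_square. form_at (a, b, c) p = 0}" if "a \<noteq> 0 \<or> b \<noteq> 0" for a b c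
      unfolding P_def
    proof (intro conjI ballI impI)
      show L: "{p \<in> unit_square. form_at (a, b, c) p = 0} \<in> sets M"
        using form_line_closed[of "(a, b, c)", THEN borel_closed] unfolding M.sets_iff by blast
      fix A assume A: "A \<in> sets M" "A \<subseteq> {p \<in> unit_square. form_at (a, b, c) p = 0}"
      have "emeasure M A = 0" "emeasure N A = 0"
        using emeasure_mono[OF A(2), of M] emeasure_mono[OF A(2), of N] L
          M.line_null[OF that, of c] N.line_null[OF that, of c] by (simp_all add: sets_eq del: form_at.simps)
      then show "n * emeasure M A = m * emeasure N A" by simp
    qed
    show "P corner_box"
      using corner_box_proportional[OF M N] M.hyp_box_sets by (auto simp: P_def m_def n_def M.sets_iff)
  qed
  then have proportional: "n * emeasure M A = m * emeasure N A" if "A \<in> sets M" for A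
    using that by (simp add: P_def M.sets_iff)
  have "unit_square \<in> sets M" by (simp add: M.sets_iff)
  \<comment> \<open>Both total masses are 1, which fixes the constant of proportionality.\<close>
  then have mn: "m = n" using proportional[of unit_square] by (simp add: M.total N.total)
  \<comment> \<open>Otherwise the covering principle, applied to null sets, would make the whole
    square null.\<close>
  have "m \<noteq> 0"
  proof
    assume m0: "m = 0"
    have "emeasure M unit_square = 0"
    proof (rule conjunct2[OF square_covered_by_corner_box[where P = "\<lambda>U. U \<in> sets M \<and> emeasure M U = 0"]])
      show "(\<Union>k. U k) \<in> sets M \<and> emeasure M (\<Union>k. U k) = 0" if "\<And>k. U k \<in> sets M \<and> emeasure M (U k) = 0"
        for U :: "nat \<Rightarrow> (real^2) set"
        using null_sets_UN[of U M] that by (simp add: null_sets_def)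
      show "V \<in> sets M \<and> emeasure M V = 0" if "U \<in> sets M \<and> emeasure M U = 0" "V \<subseteq> U" "V \<in> sets borel" for U V
        using that emeasure_mono[of V U M] unfolding M.sets_iff by auto
      show "S -` U \<inter> unit_square \<in> sets M \<and> emeasure M (S -` U \<inter> unit_square) = 0"
        if "U \<in> sets M \<and> emeasure M U = 0" "unimodular_involution ps S" for U ps S
        using that M.preimage_sets[of ps S U] M.invariant[of ps S U] by simp
      show "{p \<in> unit_square. form_at (a, b, c) p = 0} \<in> sets M \<and> emeasure M {p \<in> unit_square. form_at (a, b, c) p = 0} = 0"
        if "a \<noteq> 0 \<or> b \<noteq> 0" for a b c
        using M.line_null[OF that] form_line_closed[of "(a, b, c)", THEN borel_closed] unfolding M.sets_iff by blast
      show "corner_box \<in> sets M \<and> emeasure M corner_box = 0" using m0 M.hyp_box_sets by (simp add: m_def)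
    qed
    then show False by (simp add: M.total)
  qed
  have "m \<noteq> top" using M.finite_measure[of corner_box] by (simp add: m_def)
  show "M = N"
  proof (rule measure_eqI)
    show "sets M = sets N" using sets_eq by blast
    fix A assume "A \<in> sets M"
    then have "m * emeasure M A = m * emeasure N A" using proportional mn by simp
    then show "emeasure M A = emeasure N A"
      using \<open>m \<noteq> 0\<close> \<open>m \<noteq> top\<close> by (simp add: ennreal_mult_cancel_left)
  qed
qed

theorem theorem6:
  fixes \<mu> :: "(real^2) measure"
  assumes borel_measure: "sets \<mu> = sets (restrict_space borel unit_square)"
    and detects: "detects_pseudotruths \<mu>"
    and invariant: "automorphism_invariant \<mu>"
  shows "\<mu> = restrict_space lborel unit_square"
  by (rule unimodular_measure_unique[OF unimodular_measure_of_invariant[OF borel_measure detects invariant]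
        unimodular_measure_lborel])

end
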